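(* Let $0<\tau\le L$, $\mathcal{B}=\mathbb{R}^n$, and let $\kappa\ge1$, $\mu>0$, $0<\delta_0\le1/2$. For every $f\in\mathcal{F}_{\tau,L,\mathcal{B}}$ let $C_f$ be a function comparison oracle with parameters $(\kappa,\mu,\delta_0)$. Then there exists a coordinate-descent algorithm, which does not need to know $\kappa$, that outputs an estimate $\widehat{x}_T$ after $T$ function comparison queries such that, with probability at least $1-\delta$, \[ \sup_{f \in\mathcal{F}_{\tau,L,\mathcal{B}}} \mathbb{E} \left[ f(\widehat{x}_T) - f(x_f^* ) \right] \leq \begin{cases} c_1\exp\left\{ -c_2 \sqrt{ \frac{T}{n } }\right\} & \text{ if } \kappa = 1, \\ c_3\, n\left( \frac{n }{T} \right)^{\frac{1}{ 2 (\kappa-1)}} & \text{ if } \kappa > 1, \end{cases} \] where $c_1,c_2,c_3$ depend on the oracle and function class parameters and depend on $T$, $n$ and $1/\delta$ only poly-logarithmically.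
   Context: A function $f$ is strongly convex with constant $\tau>0$ on a convex set $\mathcal{B}\subset\mathbb{R}^n$ if $f(y)\ge f(x)+\langle\nabla f(x),y-x\rangle+\frac{\tau}{2}\|x-y\|^2$ for all $x,y\in\mathcal{B}$; its gradient is Lipschitz with constant $L$ if $\|\nabla f(x)-\nabla f(y)\|\le L\|x-y\|$. $\mathcal{F}_{\tau,L,\mathcal{B}}$ denotes the class of functions that are strongly convex with constant $\tau$ on $\mathcal{B}$, have $L$-Lipschitz gradients, and attain their minimum in $\mathcal{B}$; $x_f^*$ denotes the minimizer of $f$. A function comparison oracle for $f$ with parameters $(\kappa,\mu,\delta_0)$ returns, for any queried pair $x,y$, a binary random variable $C_f(x,y)\in\{-1,1\}$ (independently across queries given the queried points) satisfying $\mathbb{P}\left( C_f(x,y) =\mathrm{sign}\{ f(y)-f(x) \} \right) \geq \frac{1}{2}+ \min\left\{ \delta_0, \mu |f(y)-f(x)|^{\kappa-1} \right\}$; when $\kappa=1$ it is assumed that $\mu\le\delta_0\le1/2$. A coordinate-descent algorithm here is one that at each iteration picks a coordinate direction $\mathbf{e}_i$ uniformly at random and moves the current iterate along it by a step determined through oracle queries. The expectation is over the randomness of the algorithm and oracle.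
   Formalization: The sup over all f on R^n is infinite, so it is restricted to f with f(x_0)-f(x_f^* ) ≤ D (D arbitrary; algorithm and constants may depend on D); "with probability 1-δ, E[..]" is read as expectation conditional on an event of probability at least 1-δ. *)

theory Defs
  imports "HOL-Probability.Probability"
begin

text \<open>Points of R^n are represented as functions nat => real that vanish
  outside the index range {..<n}, so that the dimension n is an ordinary
  natural-number parameter (the constants must be quantified before n).\<close>

definition Rn :: "nat \<Rightarrow> (nat \<Rightarrow> real) set" where
  "Rn n = {x. \<forall>j\<ge>n. x j = 0}"

definition inner_n :: "nat \<Rightarrow> (nat \<Rightarrow> real) \<Rightarrow> (nat \<Rightarrow> real) \<Rightarrow> real" where
  "inner_n n x y = (\<Sum>j<n. x j * y j)"

definition norm_n :: "nat \<Rightarrow> (nat \<Rightarrow> real) \<Rightarrow> real" where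
  "norm_n n x = sqrt (\<Sum>j<n. (x j)\<^sup>2)"

definition vadd :: "(nat \<Rightarrow> real) \<Rightarrow> (nat \<Rightarrow> real) \<Rightarrow> (nat \<Rightarrow> real)" where
  "vadd x y = (\<lambda>j. x j + y j)"

definition vsub :: "(nat \<Rightarrow> real) \<Rightarrow> (nat \<Rightarrow> real) \<Rightarrow> (nat \<Rightarrow> real)" where
  "vsub x y = (\<lambda>j. x j - y j)"

definition vscale :: "real \<Rightarrow> (nat \<Rightarrow> real) \<Rightarrow> (nat \<Rightarrow> real)" where
  "vscale t x = (\<lambda>j. t * x j)"

definition move :: "(nat \<Rightarrow> real) \<Rightarrow> nat \<Rightarrow> real \<Rightarrow> (nat \<Rightarrow> real)" where
  "move x i t = (\<lambda>j. if j = i then x j + t else x j)"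

text \<open>g is the gradient of f on R^n: g maps into R^n and every directional
  derivative of f at x in direction v equals <g x, v>.  (With g continuous,
  which follows from the Lipschitz condition below, this is the usual gradient.)\<close>
definition is_gradient :: "nat \<Rightarrow> ((nat \<Rightarrow> real) \<Rightarrow> real) \<Rightarrow> ((nat \<Rightarrow> real) \<Rightarrow> (nat \<Rightarrow> real)) \<Rightarrow> bool" where
  "is_gradient n f g \<longleftrightarrow>
     (\<forall>x\<in>Rn n. g x \<in> Rn n \<and>
        (\<forall>v\<in>Rn n. ((\<lambda>t. f (vadd x (vscale t v))) has_real_derivative inner_n n (g x) v) (at 0)))"

definition fclass :: "real \<Rightarrow> real \<Rightarrow> nat \<Rightarrow> ((nat \<Rightarrow> real) \<Rightarrow> real) set" where
  "fclass \<tau> L n = {f. \<exists>g. is_gradient n f g \<and>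
       (\<forall>x\<in>Rn n. \<forall>y\<in>Rn n.
          f y \<ge> f x + inner_n n (g x) (vsub y x) + \<tau> / 2 * (norm_n n (vsub x y))\<^sup>2) \<and>
       (\<forall>x\<in>Rn n. \<forall>y\<in>Rn n. norm_n n (vsub (g x) (g y)) \<le> L * norm_n n (vsub x y)) \<and>
       (\<exists>xs\<in>Rn n. \<forall>y\<in>Rn n. f xs \<le> f y)}"

definition fmin :: "nat \<Rightarrow> ((nat \<Rightarrow> real) \<Rightarrow> real) \<Rightarrow> real" where
  "fmin n f = (INF y\<in>Rn n. f y)"

text \<open>Function comparison oracle: Orc x y is the law of C_f(x,y); True encodes +1,
  False encodes -1.  Independence across queries is built into the execution model
  below (a fresh sample of Orc x y is drawn at each query).  When f x = f y the sign
  is 0, which is never a possible output, so no requirement is imposed then.\<close>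
definition comparison_oracle ::
  "nat \<Rightarrow> ((nat \<Rightarrow> real) \<Rightarrow> real) \<Rightarrow> real \<Rightarrow> real \<Rightarrow> real \<Rightarrow>
   ((nat \<Rightarrow> real) \<Rightarrow> (nat \<Rightarrow> real) \<Rightarrow> bool pmf) \<Rightarrow> bool" where
  "comparison_oracle n f \<kappa> \<mu> \<delta>0 Orc \<longleftrightarrow>
     (\<forall>x\<in>Rn n. \<forall>y\<in>Rn n. f x \<noteq> f y \<longrightarrow>
        pmf (Orc x y) (f y > f x) \<ge> 1/2 + min \<delta>0 (\<mu> * \<bar>f y - f x\<bar> powr (\<kappa> - 1)))"

text \<open>An adaptive line-search procedure along a coordinate line: either stop with
  step t, or query C(x + s e_i, x + t e_i) and continue depending on the answer.\<close>
datatype lsearch = Done real | Ask real real "bool \<Rightarrow> lsearch"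

primrec ls_run :: "((nat \<Rightarrow> real) \<Rightarrow> (nat \<Rightarrow> real) \<Rightarrow> bool pmf) \<Rightarrow> (nat \<Rightarrow> real) \<Rightarrow> nat \<Rightarrow>
                    lsearch \<Rightarrow> (real \<times> bool list) pmf" where
  "ls_run Orc x i (Done t) = return_pmf (t, [])"
| "ls_run Orc x i (Ask s t k) =
     bind_pmf (Orc (move x i s) (move x i t))
       (\<lambda>b. map_pmf (\<lambda>(r, bs). (r, b # bs)) (ls_run Orc x i (k b)))"

primrec cd_run :: "nat \<Rightarrow> ((nat \<Rightarrow> real) \<Rightarrow> (nat \<Rightarrow> real) \<Rightarrow> bool pmf) \<Rightarrow>
                    (nat \<Rightarrow> nat \<Rightarrow> (nat \<Rightarrow> real) \<Rightarrow> lsearch) \<Rightarrow> (nat \<Rightarrow> real) \<Rightarrow> nat \<Rightarrow>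
                    ((nat \<Rightarrow> real) \<times> (nat \<times> bool list) list) pmf" where
  "cd_run n Orc LS x0 0 = return_pmf (x0, [])"
| "cd_run n Orc LS x0 (Suc m) =
     bind_pmf (cd_run n Orc LS x0 m) (\<lambda>(y, tr).
       bind_pmf (pmf_of_set {..<n}) (\<lambda>i.
         map_pmf (\<lambda>(t, bs). (move y i t, tr @ [(i, bs)])) (ls_run Orc y i (LS m i y))))"

definition num_queries :: "((nat \<Rightarrow> real) \<times> (nat \<times> bool list) list) \<Rightarrow> nat" where
  "num_queries \<omega> = (\<Sum>q\<leftarrow>snd \<omega>. length (snd q))"

end

theory Submission
  imports Defs
begin

text \<open>The line search is a tournament: the current point and its displacements by
  \<open>\<plusminus> W / 2 ^ j\<close>, \<open>j \<le> s\<close>, are compared successively, each comparison being decided by a majority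
  of \<open>r\<close> queries. If every comparison of values further than \<open>\<epsilon>\<close> apart is decided correctly, then
  the step decreases \<open>f\<close> by \<open>(g x i)\<^sup>2 / (8 L)\<close> up to \<open>V / 4 ^ s + 2 (s + 1) \<epsilon>\<close>. Averaged over the
  coordinate \<open>i\<close>, the expected gap on the good event contracts by \<open>1 - \<tau> / (4 L n)\<close> up to that error.

  As \<open>\<kappa>\<close> is unknown, the algorithm runs two phases. The first has about \<open>sqrt (n T)\<close> iterations with
  fine steps and few votes; for \<open>\<kappa> = 1\<close>, where \<open>\<epsilon> = 0\<close>, it gives the exponential rate, and the second
  phase cannot increase \<open>f\<close>. The second has about \<open>n\<close> iterations with many votes. For \<open>\<kappa> > 1\<close> the
  first phase has resolution \<open>\<epsilon> = 1\<close>, so it raises the gap to \<open>D + T\<close> at most. The second phase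
  forgets this factor, because its number of iterations per coordinate is quadratic in the logarithm.\<close>

section \<open>Majority votes and tournaments\<close>

text \<open>A trace keeps the answers of a line search but not the step it chose; the step is
  recovered from the answers.\<close>

primrec replay :: "lsearch \<Rightarrow> bool list \<Rightarrow> real" where
  "replay (Done t) bs = t"
| "replay (Ask s t k) bs = replay (k (hd bs)) (tl bs)"

lemma replay_ls_run: "(t, bs) \<in> set_pmf (ls_run Orc x i ls) \<Longrightarrow> replay ls bs = t"
  by (induction ls arbitrary: t bs) auto

text \<open>Finite support makes every real function integrable, which settles the integrability
  conditions for the expectations below.\<close>

lemma finite_set_pmf_ls_run: "finite (set_pmf (ls_run Orc x i ls))"
proof (induction ls)
  case (Ask s t k)
  then show ?case by (auto intro: finite_subset[OF subset_UNIV])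
qed simp

text \<open>\<open>d\<close> is the running score. A tie is decided as \<open>False\<close>. The
  score is real because it becomes an exponent of \<open>powr\<close> in the Chernoff bound.\<close>

primrec vote :: "real \<Rightarrow> real \<Rightarrow> nat \<Rightarrow> real \<Rightarrow> (bool \<Rightarrow> lsearch) \<Rightarrow> lsearch" where
  "vote s t 0 d k = k (d > 0)"
| "vote s t (Suc r) d k = Ask s t (\<lambda>b. vote s t r (if b then d + 1 else d - 1) k)"

primrec tournament :: "nat \<Rightarrow> real list \<Rightarrow> real \<Rightarrow> lsearch" where
  "tournament r [] c = Done c"
| "tournament r (u # us) c = vote c u r 0 (\<lambda>b. tournament r us (if b then c else u))"

lemma length_vote:
  assumes "\<And>b t' bs. (t', bs) \<in> set_pmf (ls_run Orc x i (k b)) \<Longrightarrow> length bs = l"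
    and "(t', bs) \<in> set_pmf (ls_run Orc x i (vote s t r d k))"
  shows "length bs = r + l"
  using assms(2) by (induction r arbitrary: d bs) (fastforce dest: assms(1))+

lemma length_tournament:
  "(t, bs) \<in> set_pmf (ls_run Orc x i (tournament r us c)) \<Longrightarrow> length bs = length us * r"
proof (induction us arbitrary: c t bs)
  case (Cons u us)
  then show ?case using length_vote[where l = "length us * r"] by fastforce
qed simp

section \<open>Failure probabilities of votes and tournaments\<close>

definition failure ::
  "((nat \<Rightarrow> real) \<Rightarrow> (nat \<Rightarrow> real) \<Rightarrow> bool pmf) \<Rightarrow> (nat \<Rightarrow> real) \<Rightarrow> nat \<Rightarrow> (real \<Rightarrow> bool) \<Rightarrow> lsearch \<Rightarrow> real"
where
  "failure Orc x i Q ls = measure_pmf.expectation (ls_run Orc x i ls) (\<lambda>\<omega>. of_bool (\<not> Q (fst \<omega>)))"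

lemma failure_Done: "failure Orc x i Q (Done t) = (if Q t then 0 else 1)"
  by (simp add: failure_def)

lemma failure_Ask:
  "failure Orc x i Q (Ask s t k) =
     pmf (Orc (move x i s) (move x i t)) True * failure Orc x i Q (k True) +
     pmf (Orc (move x i s) (move x i t)) False * failure Orc x i Q (k False)"
  unfolding failure_def ls_run.simps
  by (subst pmf_expectation_bind[of UNIV])
    (auto simp: finite_set_pmf_ls_run UNIV_bool case_prod_unfold)

lemma failure_mono:
  assumes "\<And>t. Q' t \<Longrightarrow> Q t"
  shows "failure Orc x i Q ls \<le> failure Orc x i Q' ls"
  unfolding failure_def
  by (intro integral_mono integrable_measure_pmf_finite finite_set_pmf_ls_run) (use assms in auto)

lemma failure_le_1: "failure Orc x i Q ls \<le> 1"
  using failure_mono[of "\<lambda>_. False" Q Orc x i ls] by (simp add: failure_def)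

lemma failure_nonneg: "0 \<le> failure Orc x i Q ls"
  unfolding failure_def by (simp add: integral_nonneg_AE)

text \<open>One factor of the Chernoff bound for the weight \<open>(1 + \<gamma>) powr - d\<close> of the score.\<close>
lemma chernoff_factor:
  fixes p \<gamma> :: real
  assumes "0 \<le> \<gamma>" "1/2 + \<gamma> \<le> p"
  shows "p * (1 + \<gamma>) powr - 1 + (1 - p) * (1 + \<gamma>) \<le> exp (- \<gamma>\<^sup>2)"
proof -
  have "p + (1 - p) * (1 + \<gamma>)\<^sup>2 = (1 + \<gamma>)\<^sup>2 - p * (2 * \<gamma> + \<gamma>\<^sup>2)"
    by (simp add: algebra_simps power2_eq_square)
  also have "\<dots> \<le> (1 + \<gamma>)\<^sup>2 - (1/2 + \<gamma>) * (2 * \<gamma> + \<gamma>\<^sup>2)"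
    using assms by (intro diff_left_mono mult_right_mono) auto
  also have "\<dots> \<le> (1 - \<gamma>\<^sup>2) * (1 + \<gamma>)"
    using assms by (simp add: algebra_simps power2_eq_square)
  also have "\<dots> \<le> exp (- \<gamma>\<^sup>2) * (1 + \<gamma>)"
    using assms exp_ge_add_one_self[of "- \<gamma>\<^sup>2"] by (intro mult_right_mono) auto
  finally show ?thesis
    using assms by (simp add: powr_minus divide_simps power2_eq_square algebra_simps)
qed

text \<open>Induction on \<open>r\<close> for an arbitrary score. The weight
  \<open>(1 + \<gamma>) powr (- d)\<close> is at least 1 when the vote ends wrongly, that is with
  \<open>d \<le> 0\<close>, and each vote multiplies its mean by at most
  \<open>exp (- \<gamma>\<^sup>2)\<close>.\<close>

lemma failure_vote_True:
  assumes "0 \<le> \<gamma>" "1/2 + \<gamma> \<le> pmf (Orc (move x i s) (move x i t)) True"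
  shows "failure Orc x i Q (vote s t r d k)
           \<le> failure Orc x i Q (k True) + (1 + \<gamma>) powr (- d) * exp (- (real r * \<gamma>\<^sup>2))"
proof (induction r arbitrary: d)
  case 0
  show ?case
  proof (cases "d > 0")
    case False
    then have "1 \<le> (1 + \<gamma>) powr (- d)" using assms by (simp add: ge_one_powr_ge_zero)
    then show ?thesis
      using False failure_le_1[of Orc x i Q "k False"] failure_nonneg[of Orc x i Q "k True"] by simp
  qed simp
next
  case (Suc r)
  let ?p = "pmf (Orc (move x i s) (move x i t)) True"
  let ?F = "failure Orc x i Q" and ?e = "exp (- (real r * \<gamma>\<^sup>2))"
  have shift: "(1 + \<gamma>) powr (- (d + 1)) = (1 + \<gamma>) powr (- d) * (1 + \<gamma>) powr - 1"
    "(1 + \<gamma>) powr (- (d - 1)) = (1 + \<gamma>) powr (- d) * (1 + \<gamma>)"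
    using assms(1) powr_add[of "1 + \<gamma>" "- d" "- 1"] powr_add[of "1 + \<gamma>" "- d" 1] by simp_all
  have "?F (vote s t (Suc r) d k) \<le> ?p * (?F (k True) + (1 + \<gamma>) powr (- (d + 1)) * ?e)
      + (1 - ?p) * (?F (k True) + (1 + \<gamma>) powr (- (d - 1)) * ?e)"
    unfolding vote.simps failure_Ask pmf_False_conv_True if_True if_False
    by (intro add_mono mult_left_mono Suc.IH) (auto simp: pmf_le_1)
  also have "\<dots> = ?F (k True) + (1 + \<gamma>) powr (- d) * ?e * (?p * (1 + \<gamma>) powr - 1 + (1 - ?p) * (1 + \<gamma>))"
    unfolding shift by (simp add: algebra_simps)
  also have "\<dots> \<le> ?F (k True) + (1 + \<gamma>) powr (- d) * ?e * exp (- \<gamma>\<^sup>2)"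
    by (intro add_left_mono mult_left_mono chernoff_factor assms) auto
  also have "\<dots> = ?F (k True) + (1 + \<gamma>) powr (- d) * exp (- (real (Suc r) * \<gamma>\<^sup>2))"
    by (simp add: exp_add[symmetric] algebra_simps)
  finally show ?case .
qed

text \<open>The mirror image: the wrong outcome is now \<open>d > 0\<close>, so the weight is
  \<open>(1 + \<gamma>) powr d\<close>.\<close>

lemma failure_vote_False:
  assumes "0 \<le> \<gamma>" "1/2 + \<gamma> \<le> pmf (Orc (move x i s) (move x i t)) False"
  shows "failure Orc x i Q (vote s t r d k)
           \<le> failure Orc x i Q (k False) + (1 + \<gamma>) powr d * exp (- (real r * \<gamma>\<^sup>2))"
proof (induction r arbitrary: d)
  case 0
  show ?case
  proof (cases "d > 0")
    case True
    then have "1 \<le> (1 + \<gamma>) powr d" using assms by (simp add: ge_one_powr_ge_zero)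
    then show ?thesis
      using True failure_le_1[of Orc x i Q "k True"] failure_nonneg[of Orc x i Q "k False"] by simp
  qed simp
next
  case (Suc r)
  let ?p = "pmf (Orc (move x i s) (move x i t)) False"
  let ?F = "failure Orc x i Q" and ?e = "exp (- (real r * \<gamma>\<^sup>2))"
  have p: "pmf (Orc (move x i s) (move x i t)) True = 1 - ?p" by (simp add: pmf_False_conv_True)
  have shift: "(1 + \<gamma>) powr (d - 1) = (1 + \<gamma>) powr d * (1 + \<gamma>) powr - 1"
    "(1 + \<gamma>) powr (d + 1) = (1 + \<gamma>) powr d * (1 + \<gamma>)"
    using assms(1) powr_add[of "1 + \<gamma>" d "- 1"] powr_add[of "1 + \<gamma>" d 1] by simp_all
  have "?F (vote s t (Suc r) d k) \<le> (1 - ?p) * (?F (k False) + (1 + \<gamma>) powr (d + 1) * ?e)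
      + ?p * (?F (k False) + (1 + \<gamma>) powr (d - 1) * ?e)"
    unfolding vote.simps failure_Ask p if_True if_False
    by (intro add_mono mult_left_mono Suc.IH) (auto simp: pmf_le_1)
  also have "\<dots> = ?F (k False) + (1 + \<gamma>) powr d * ?e * (?p * (1 + \<gamma>) powr - 1 + (1 - ?p) * (1 + \<gamma>))"
    unfolding shift by (simp add: algebra_simps)
  also have "\<dots> \<le> ?F (k False) + (1 + \<gamma>) powr d * ?e * exp (- \<gamma>\<^sup>2)"
    by (intro add_left_mono mult_left_mono chernoff_factor assms) auto
  also have "\<dots> = ?F (k False) + (1 + \<gamma>) powr d * exp (- (real (Suc r) * \<gamma>\<^sup>2))"
    by (simp add: exp_add[symmetric] algebra_simps)
  finally show ?case .
qed

text \<open>A vote only mixes its two continuations. This serves the comparison of nearly equal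
  values, where either outcome is acceptable and nothing is assumed about the oracle.\<close>

lemma failure_vote_le:
  assumes "\<And>b. failure Orc x i Q (k b) \<le> B"
  shows "failure Orc x i Q (vote s t r d k) \<le> B"
proof (induction r arbitrary: d)
  case (Suc r)
  have "failure Orc x i Q (vote s t (Suc r) d k) \<le> pmf (Orc (move x i s) (move x i t)) True * B
      + (1 - pmf (Orc (move x i s) (move x i t)) True) * B"
    unfolding vote.simps failure_Ask pmf_False_conv_True if_True if_False
    by (intro add_mono mult_left_mono Suc.IH) (auto simp: pmf_le_1)
  then show ?case by (simp add: algebra_simps)
qed (simp add: assms)

text \<open>Union bound: each comparison adds one vote error to the failure probability and one
  \<open>\<epsilon>\<close> to the loss of the final winner against the candidates.\<close>

lemma failure_tournament:
  fixes \<phi> :: "real \<Rightarrow> real"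
  assumes "0 \<le> \<gamma>" and "0 \<le> \<epsilon>"
    and reliable: "\<And>s t. \<epsilon> < \<bar>\<phi> t - \<phi> s\<bar> \<Longrightarrow>
           1/2 + \<gamma> \<le> pmf (Orc (move x i s) (move x i t)) (\<phi> s < \<phi> t)"
  shows "failure Orc x i (\<lambda>t. \<forall>u\<in>insert c (set us). \<phi> t \<le> \<phi> u + real (length us) * \<epsilon>)
           (tournament r us c) \<le> real (length us) * exp (- (real r * \<gamma>\<^sup>2))"
proof (induction us arbitrary: c)
  case Nil
  then show ?case by (simp add: failure_Done)
next
  case (Cons u us)
  let ?Q = "\<lambda>t. \<forall>v\<in>insert c (set (u # us)). \<phi> t \<le> \<phi> v + real (length (u # us)) * \<epsilon>"
  let ?k = "\<lambda>b. tournament r us (if b then c else u)"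
  let ?e = "exp (- (real r * \<gamma>\<^sup>2))"
  \<comment> \<open>Whoever is within \<open>\<epsilon>\<close> of both candidates may survive; the
    remaining comparisons lose \<open>real (length us) * \<epsilon>\<close> more.\<close>
  have winner: "failure Orc x i ?Q (tournament r us w) \<le> real (length us) * ?e"
    if "\<phi> w \<le> \<phi> c + \<epsilon>" "\<phi> w \<le> \<phi> u + \<epsilon>" for w
  proof -
    have "failure Orc x i ?Q (tournament r us w)
        \<le> failure Orc x i (\<lambda>t. \<forall>u\<in>insert w (set us). \<phi> t \<le> \<phi> u + real (length us) * \<epsilon>) (tournament r us w)"
      using that \<open>0 \<le> \<epsilon>\<close> by (intro failure_mono) (force simp: algebra_simps)
    then show ?thesis using Cons.IH[of w] by linarith
  qed
  \<comment> \<open>In the first case both candidates qualify, whatever the vote; in the other two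
    the oracle favours the smaller value with advantage \<open>\<gamma>\<close>.\<close>
  consider "\<bar>\<phi> u - \<phi> c\<bar> \<le> \<epsilon>" | "\<epsilon> < \<bar>\<phi> u - \<phi> c\<bar>" "\<phi> c < \<phi> u" | "\<epsilon> < \<bar>\<phi> u - \<phi> c\<bar>" "\<phi> u < \<phi> c"
    using \<open>0 \<le> \<epsilon>\<close> by linarith
  then have "failure Orc x i ?Q (vote c u r 0 ?k) \<le> real (length us) * ?e + ?e"
  proof cases
    case 1
    have "failure Orc x i ?Q (vote c u r 0 ?k) \<le> real (length us) * ?e"
      by (rule failure_vote_le, rule winner) (use 1 \<open>0 \<le> \<epsilon>\<close> in auto)
    then show ?thesis by (simp add: add_increasing2)
  next
    case 2
    then have p: "1/2 + \<gamma> \<le> pmf (Orc (move x i c) (move x i u)) True"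
      using reliable[of u c] by simp
    show ?thesis
      using failure_vote_True[of \<gamma> Orc x i c u, OF \<open>0 \<le> \<gamma>\<close> p, of ?Q r 0 ?k] winner[of c] 2 assms(1,2) by simp
  next
    case 3
    then have p: "1/2 + \<gamma> \<le> pmf (Orc (move x i c) (move x i u)) False"
      using reliable[of u c] by simp
    show ?thesis
      using failure_vote_False[of \<gamma> Orc x i c u, OF \<open>0 \<le> \<gamma>\<close> p, of ?Q r 0 ?k] winner[of u] 3 assms(1,2) by simp
  qed
  then show ?case by (simp add: algebra_simps)
qed

section \<open>Smooth strongly convex functions along coordinate lines\<close>

lemma move_Rn: "x \<in> Rn n \<Longrightarrow> i < n \<Longrightarrow> move x i t \<in> Rn n"
  by (auto simp: Rn_def move_def)

lemma move_0: "move x i 0 = x"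
  by (auto simp: move_def)

text \<open>A geometric grid approximates all lengths between its extremes up to a factor 2. Both
  signs occur because the sign of the derivative is unknown.\<close>

definition steps :: "real \<Rightarrow> nat \<Rightarrow> real list" where
  "steps W s = map (\<lambda>j. W / 2 ^ j) [0..<Suc s] @ map (\<lambda>j. - (W / 2 ^ j)) [0..<Suc s]"

lemma length_steps: "length (steps W s) = 2 * Suc s"
  by (simp add: steps_def)

lemma set_steps: "set (steps W s) = (\<lambda>j. W / 2 ^ j) ` {..s} \<union> (\<lambda>j. - (W / 2 ^ j)) ` {..s}"
  unfolding steps_def set_append set_map set_upt by (simp add: atLeast0LessThan lessThan_Suc_atMost)

text \<open>The least \<open>j\<close> with \<open>W / 2 ^ j \<le> a\<close> works: the preceding
  grid point exceeds \<open>a\<close>, and for \<open>j = 0\<close> the bound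
  \<open>a \<le> W\<close> takes its place.\<close>

lemma dyadic_step:
  fixes a W :: real
  assumes "0 \<le> W" "a \<le> W" "W / 2 ^ s \<le> a"
  obtains j where "j \<le> s" "W / 2 ^ j \<le> a" "a \<le> 2 * (W / 2 ^ j)"
proof -
  define j where "j = (LEAST j. W / 2 ^ j \<le> a)"
  have j: "W / 2 ^ j \<le> a" "j \<le> s"
    unfolding j_def using assms(3) by (auto intro: LeastI Least_le)
  have "a \<le> 2 * (W / 2 ^ j)"
  proof (cases j)
    case 0
    then show ?thesis using assms(1,2) by simp
  next
    case (Suc j')
    then have "\<not> W / 2 ^ j' \<le> a" unfolding j_def by (metis lessI not_less_Least)
    then show ?thesis by (simp add: Suc)
  qed
  then show ?thesis using j that by blast
qed

locale smooth_strongly_convex =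
  fixes n :: nat and f :: "(nat \<Rightarrow> real) \<Rightarrow> real" and g :: "(nat \<Rightarrow> real) \<Rightarrow> nat \<Rightarrow> real"
    and \<tau> L :: real
  assumes n_pos: "1 \<le> n" and tau_pos: "0 < \<tau>" and tau_le_L: "\<tau> \<le> L"
    and strong_convex: "\<And>x y. x \<in> Rn n \<Longrightarrow> y \<in> Rn n \<Longrightarrow>
          f x + inner_n n (g x) (vsub y x) + \<tau> / 2 * (norm_n n (vsub x y))\<^sup>2 \<le> f y"
    and gradient_Lipschitz: "\<And>x y. x \<in> Rn n \<Longrightarrow> y \<in> Rn n \<Longrightarrow>
          norm_n n (vsub (g x) (g y)) \<le> L * norm_n n (vsub x y)"
    and min_attained: "\<exists>x\<in>Rn n. \<forall>y\<in>Rn n. f x \<le> f y"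
begin

definition gap :: "(nat \<Rightarrow> real) \<Rightarrow> real" where
  "gap x = f x - fmin n f"

lemma L_pos: "0 < L"
  using tau_pos tau_le_L by simp

lemma gap_nonneg: "x \<in> Rn n \<Longrightarrow> 0 \<le> gap x"
  unfolding gap_def fmin_def using min_attained by (auto intro!: cINF_lower bdd_belowI2)

text \<open>Convexity at the moved point bounds the change by \<open>g ?y i * t\<close>, and the
  Lipschitz condition replaces \<open>g ?y i\<close> by \<open>g x i\<close>. This avoids
  integrating the derivative, at the price of \<open>L * t\<^sup>2\<close> instead of half of
  it.\<close>

lemma coordinate_descent_lemma:
  assumes x: "x \<in> Rn n" and i: "i < n"
  shows "f (move x i t) \<le> f x + g x i * t + L * t\<^sup>2"
proof -
  let ?y = "move x i t"
  have y: "?y \<in> Rn n" using x i by (rule move_Rn)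
  have "inner_n n (g ?y) (vsub x ?y) = (\<Sum>j<n. if j = i then - (g ?y i * t) else 0)"
    unfolding inner_n_def by (intro sum.cong) (auto simp: vsub_def move_def)
  then have inner: "inner_n n (g ?y) (vsub x ?y) = - (g ?y i * t)" using i by simp
  have "f ?y + inner_n n (g ?y) (vsub x ?y) \<le> f x"
    using order.trans[OF _ strong_convex[OF y x]] tau_pos by simp
  then have f_le: "f ?y \<le> f x + g ?y i * t" by (simp add: inner)
  have "(\<Sum>j<n. (vsub ?y x j)\<^sup>2) = (\<Sum>j<n. if j = i then t\<^sup>2 else 0)"
    by (intro sum.cong) (auto simp: vsub_def move_def)
  then have norm: "norm_n n (vsub ?y x) = \<bar>t\<bar>" using i by (simp add: norm_n_def)
  have "\<bar>g ?y i - g x i\<bar> \<le> norm_n n (vsub (g ?y) (g x))"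
    unfolding norm_n_def
    by (rule real_le_rsqrt) (use i in \<open>auto simp: vsub_def intro!: member_le_sum[of i "{..<n}" "\<lambda>j. (g ?y j - g x j)\<^sup>2"]\<close>)
  then have "\<bar>g ?y i - g x i\<bar> \<le> L * \<bar>t\<bar>"
    using gradient_Lipschitz[OF y x] norm by simp
  then have "\<bar>(g ?y i - g x i) * t\<bar> \<le> L * \<bar>t\<bar> * \<bar>t\<bar>"
    unfolding abs_mult by (rule mult_right_mono) simp
  then have "(g ?y i - g x i) * t \<le> L * \<bar>t\<bar> * \<bar>t\<bar>" by linarith
  then show ?thesis using f_le by (simp add: algebra_simps power2_eq_square)
qed

text \<open>The step minimizing the quadratic upper bound cannot lead below the minimum. The result
  keeps the ideal step length within the range \<open>sqrt (V / L)\<close> of the grid.\<close>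

lemma gradient_component_le_gap:
  assumes x: "x \<in> Rn n" and i: "i < n"
  shows "(g x i)\<^sup>2 \<le> 4 * L * gap x"
proof -
  have "0 \<le> gap (move x i (- g x i / (2 * L)))" using x i by (intro gap_nonneg move_Rn)
  also have "\<dots> \<le> gap x - (g x i)\<^sup>2 / (4 * L)"
    using coordinate_descent_lemma[OF x i, of "- g x i / (2 * L)"] L_pos
    by (simp add: gap_def power2_eq_square field_simps)
  finally show ?thesis using L_pos by (simp add: field_simps)
qed

text \<open>The Polyak-Lojasiewicz inequality: minimize the strong convexity lower bound over
  \<open>y\<close>, coordinate by coordinate.\<close>

lemma gap_le_gradient:
  assumes x: "x \<in> Rn n"
  shows "2 * \<tau> * gap x \<le> (\<Sum>i<n. (g x i)\<^sup>2)"
proof -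
  have "f x - (\<Sum>i<n. (g x i)\<^sup>2) / (2 * \<tau>) \<le> f y" if y: "y \<in> Rn n" for y
  proof -
    have "- ((\<Sum>i<n. (g x i)\<^sup>2) / (2 * \<tau>)) \<le> (\<Sum>i<n. g x i * (y i - x i) + \<tau> / 2 * (x i - y i)\<^sup>2)"
      unfolding sum_divide_distrib sum_negf[symmetric]
    proof (rule sum_mono)
      fix i
      \<comment> \<open>Completing the square in \<open>y i - x i\<close>.\<close>
      have "0 \<le> (g x i + \<tau> * (y i - x i))\<^sup>2 / (2 * \<tau>)" using tau_pos by simp
      also have "\<dots> = (g x i)\<^sup>2 / (2 * \<tau>) + (g x i * (y i - x i) + \<tau> / 2 * (x i - y i)\<^sup>2)"
        using tau_pos by (simp add: power2_eq_square field_simps)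
      finally show "- ((g x i)\<^sup>2 / (2 * \<tau>)) \<le> g x i * (y i - x i) + \<tau> / 2 * (x i - y i)\<^sup>2" by simp
    qed
    also have "\<dots> = inner_n n (g x) (vsub y x) + \<tau> / 2 * (norm_n n (vsub x y))\<^sup>2"
      by (simp add: inner_n_def norm_n_def vsub_def sum.distrib sum_distrib_left sum_nonneg)
    finally show ?thesis using strong_convex[OF x y] by simp
  qed
  then have "f x - (\<Sum>i<n. (g x i)\<^sup>2) / (2 * \<tau>) \<le> fmin n f"
    unfolding fmin_def by (intro cINF_greatest) (use x in auto)
  then show ?thesis using tau_pos by (simp add: gap_def field_simps)
qed

text \<open>The quadratic upper bound is minimal at distance \<open>a\<close> and there decreases by
  \<open>L * a\<^sup>2\<close>. A grid point between \<open>a / 2\<close> and \<open>a\<close> keeps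
  at least half of this. If \<open>a\<close> lies below the finest grid point, the decrease demanded
  is at most \<open>V / 4 ^ s\<close>, and not moving suffices.\<close>

lemma some_step_decreases:
  assumes x: "x \<in> Rn n" and i: "i < n" and V: "gap x \<le> V"
  shows "\<exists>u\<in>insert 0 (set (steps (sqrt (V / L)) s)).
           f (move x i u) \<le> f x - (g x i)\<^sup>2 / (8 * L) + V / 4 ^ s"
proof -
  define W where "W = sqrt (V / L)"
  define a where "a = \<bar>g x i\<bar> / (2 * L)"
  have V0: "0 \<le> V" using gap_nonneg[OF x] V by simp
  have ga: "\<bar>g x i\<bar> = 2 * L * a" using L_pos by (simp add: a_def)
  have g2: "(g x i)\<^sup>2 = 4 * L\<^sup>2 * a\<^sup>2"
    using arg_cong[OF ga, of "\<lambda>z. z\<^sup>2"] by (simp add: power_mult_distrib)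
  have W2: "L * W\<^sup>2 = V" using V0 L_pos by (simp add: W_def)
  have a0: "0 \<le> a" and W0: "0 \<le> W" using L_pos V0 by (auto simp: a_def W_def)
  have "4 * L * (L * a\<^sup>2) = (g x i)\<^sup>2" unfolding g2 by (simp add: power2_eq_square)
  also have "\<dots> \<le> 4 * L * V"
    by (rule order.trans[OF gradient_component_le_gap[OF x i] mult_left_mono[OF V]])
      (use L_pos in simp)
  finally have "L * a\<^sup>2 \<le> V" by (rule mult_left_le_imp_le) (use L_pos in simp)
  then have "a\<^sup>2 \<le> V / L" using L_pos by (simp add: pos_le_divide_eq mult.commute)
  then have aW: "a \<le> W" unfolding W_def by (rule real_le_rsqrt)
  have decrease: "(g x i)\<^sup>2 / (8 * L) = L * a\<^sup>2 / 2"
    unfolding g2 using L_pos by (simp add: power2_eq_square)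
  show ?thesis
  proof (cases "W / 2 ^ s \<le> a")
    case True
    then obtain j where j: "j \<le> s" "W / 2 ^ j \<le> a" "a \<le> 2 * (W / 2 ^ j)"
      using dyadic_step W0 aW by blast
    define w where "w = W / 2 ^ j"
    define u where "u = (if g x i \<le> 0 then w else - w)"
    have "u \<in> set (steps W s)" using j(1) by (auto simp: set_steps u_def w_def)
    moreover have "f (move x i u) \<le> f x - (g x i)\<^sup>2 / (8 * L) + V / 4 ^ s"
    proof -
      have w: "0 \<le> w" "w \<le> a" "a \<le> 2 * w" using j W0 by (simp_all add: w_def)
      \<comment> \<open>Here \<open>w\<close> is at least \<open>a / 2\<close> and
        \<open>2 * a - w\<close> is at least \<open>a\<close>.\<close>
      have "(a / 2) * a \<le> w * (2 * a - w)"
        using w a0 by (intro mult_mono) auto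
      then have "a\<^sup>2 / 2 \<le> 2 * a * w - w\<^sup>2" by (simp add: power2_eq_square algebra_simps)
      then have "L * (a\<^sup>2 / 2) \<le> L * (2 * a * w - w\<^sup>2)"
        by (rule mult_left_mono) (use L_pos in simp)
      moreover have gu: "g x i * u = - (2 * L * a * w)" "u\<^sup>2 = w\<^sup>2"
        unfolding ga[symmetric] by (auto simp: u_def)
      have "g x i * u + L * u\<^sup>2 = - (L * (2 * a * w - w\<^sup>2))"
        unfolding gu by (simp add: algebra_simps)
      ultimately have "g x i * u + L * u\<^sup>2 \<le> - (L * a\<^sup>2 / 2)" by simp
      moreover have "0 \<le> V / 4 ^ s" using V0 by simp
      ultimately show ?thesis
        using coordinate_descent_lemma[OF x i, of u] unfolding decrease by linarith
    qed
    ultimately show ?thesis unfolding W_def by blast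
  next
    case False
    then have "a\<^sup>2 \<le> (W / 2 ^ s)\<^sup>2" using a0 by (intro power_mono) auto
    then have "L * a\<^sup>2 \<le> L * (W / 2 ^ s)\<^sup>2" using L_pos by (intro mult_left_mono) auto
    also have "(W / 2 ^ s)\<^sup>2 = W\<^sup>2 / 4 ^ s"
      by (simp add: power_divide power2_eq_square flip: power_mult_distrib)
    also have "L * (W\<^sup>2 / 4 ^ s) = V / 4 ^ s" using W2 by simp
    finally have "L * a\<^sup>2 \<le> V / 4 ^ s" .
    moreover have "0 \<le> L * a\<^sup>2" using L_pos by simp
    ultimately have "(g x i)\<^sup>2 / (8 * L) \<le> V / 4 ^ s" unfolding decrease by linarith
    then show ?thesis by (auto simp: move_0)
  qed
qed

end

section \<open>Random coordinate descent with noisy line searches\<close>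

lemma finite_set_pmf_cd_run: "1 \<le> n \<Longrightarrow> finite (set_pmf (cd_run n Orc LS x0 m))"
  by (induction m) (auto simp: finite_set_pmf_ls_run set_pmf_of_set lessThan_empty_iff)

text \<open>The answers recorded in a trace determine the iterates, so the event that every step of the
  run is good is a set of traces.\<close>
primrec position ::
  "(nat \<Rightarrow> nat \<Rightarrow> (nat \<Rightarrow> real) \<Rightarrow> lsearch) \<Rightarrow> (nat \<Rightarrow> real) \<Rightarrow> (nat \<times> bool list) list \<Rightarrow> nat \<Rightarrow> (nat \<Rightarrow> real)"
where
  "position LS x0 tr 0 = x0"
| "position LS x0 tr (Suc k) =
     move (position LS x0 tr k) (fst (tr ! k))
       (replay (LS k (fst (tr ! k)) (position LS x0 tr k)) (snd (tr ! k)))"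

lemma position_append:
  "k \<le> length tr \<Longrightarrow> position LS x0 (tr @ tr') k = position LS x0 tr k"
  by (induction k) (auto simp: nth_append)

lemma cd_run_support:
  assumes "1 \<le> n" "x0 \<in> Rn n" "(y, tr) \<in> set_pmf (cd_run n Orc LS x0 m)"
  shows "length tr = m \<and> y \<in> Rn n \<and> position LS x0 tr m = y"
  using assms(3)
proof (induction m arbitrary: y tr)
  case (Suc m)
  then obtain z tr' i t bs where *: "(z, tr') \<in> set_pmf (cd_run n Orc LS x0 m)" "i < n"
      "(t, bs) \<in> set_pmf (ls_run Orc z i (LS m i z))" "y = move z i t" "tr = tr' @ [(i, bs)]"
    using assms(1) by (auto simp: set_pmf_of_set lessThan_empty_iff)
  then show ?case
    using Suc.IH[of z tr'] by (auto simp: position_append nth_append move_Rn dest: replay_ls_run)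
qed (use assms(2) in simp)

lemma num_queries_cd_run:
  assumes "1 \<le> n"
    and "\<And>k i y t bs. (t, bs) \<in> set_pmf (ls_run Orc y i (LS k i y)) \<Longrightarrow> length bs = l k"
    and "\<omega> \<in> set_pmf (cd_run n Orc LS x0 m)"
  shows "num_queries \<omega> = (\<Sum>k<m. l k)"
  using assms(3)
proof (induction m arbitrary: \<omega>)
  case (Suc m)
  then obtain z tr i t bs where *: "(z, tr) \<in> set_pmf (cd_run n Orc LS x0 m)"
      "(t, bs) \<in> set_pmf (ls_run Orc z i (LS m i z))" "\<omega> = (move z i t, tr @ [(i, bs)])"
    using assms(1) by (auto simp: set_pmf_of_set lessThan_empty_iff)
  then show ?case using Suc.IH[OF *(1)] assms(2)[OF *(2)] by (simp add: num_queries_def)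
qed (simp add: num_queries_def)

text \<open>The tower rule for one iteration: \<open>u\<close> bounds the conditional mean of
  \<open>h\<close> given the history, in which the uniform choice of coordinate is a plain average.
  The trace is carried along because the good event depends on it.\<close>

lemma expectation_cd_run_Suc_le:
  fixes h u :: "(nat \<Rightarrow> real) \<times> (nat \<times> bool list) list \<Rightarrow> real"
  assumes n: "1 \<le> n"
    and step: "\<And>y tr. (y, tr) \<in> set_pmf (cd_run n Orc LS x0 m) \<Longrightarrow>
      (\<Sum>i<n. measure_pmf.expectation (ls_run Orc y i (LS m i y))
         (\<lambda>(t, bs). h (move y i t, tr @ [(i, bs)]))) \<le> real n * u (y, tr)"
  shows "measure_pmf.expectation (cd_run n Orc LS x0 (Suc m)) h
           \<le> measure_pmf.expectation (cd_run n Orc LS x0 m) u"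
proof -
  let ?R = "cd_run n Orc LS x0 m"
  let ?K = "\<lambda>(y, tr). pmf_of_set {..<n} \<bind> (\<lambda>i.
         map_pmf (\<lambda>(t, bs). (move y i t, tr @ [(i, bs)])) (ls_run Orc y i (LS m i y)))"
  have fin: "finite (set_pmf ?R)" using n by (rule finite_set_pmf_cd_run)
  have ne: "{..<n} \<noteq> {}" using n by (simp add: lessThan_empty_iff)
  have set_n: "set_pmf (pmf_of_set {..<n}) = {..<n}" using ne by (simp add: set_pmf_of_set)
  have K: "measure_pmf.expectation (?K (y, tr)) h \<le> u (y, tr)" if "(y, tr) \<in> set_pmf ?R" for y tr
  proof -
    have "measure_pmf.expectation (?K (y, tr)) h =
      (\<Sum>i<n. measure_pmf.expectation (ls_run Orc y i (LS m i y))
         (\<lambda>(t, bs). h (move y i t, tr @ [(i, bs)]))) / real n"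
      unfolding prod.case
      by (subst pmf_expectation_bind_pmf_of_set)
        (use ne in \<open>auto simp: finite_set_pmf_ls_run sum_divide_distrib case_prod_unfold field_simps\<close>)
    also have "\<dots> \<le> u (y, tr)" using step[OF that] n by (simp add: divide_le_eq mult.commute)
    finally show ?thesis .
  qed
  have "measure_pmf.expectation (cd_run n Orc LS x0 (Suc m)) h
      = (\<Sum>\<omega>\<in>set_pmf ?R. pmf ?R \<omega> * measure_pmf.expectation (?K \<omega>) h)"
    unfolding cd_run.simps
    by (subst pmf_expectation_bind[of "set_pmf ?R"])
      (use fin in \<open>auto simp: finite_set_pmf_ls_run set_n\<close>)
  also have "\<dots> \<le> (\<Sum>\<omega>\<in>set_pmf ?R. pmf ?R \<omega> * u \<omega>)"
    using K by (intro sum_mono mult_left_mono) auto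
  also have "\<dots> = measure_pmf.expectation ?R u"
    by (subst integral_measure_pmf[of "set_pmf ?R"]) (use fin in auto)
  finally show ?thesis .
qed

text \<open>Reduces the conditional expectation to an expectation restricted to \<open>G\<close>,
  for which a recursion over the iterations is available.\<close>

lemma expectation_cond_pmf_finite:
  fixes h :: "'a \<Rightarrow> real"
  assumes fin: "finite (set_pmf p)" and pos: "0 < measure_pmf.prob p G"
  shows "measure_pmf.expectation (cond_pmf p G) h =
    measure_pmf.expectation p (\<lambda>\<omega>. if \<omega> \<in> G then h \<omega> else 0) / measure_pmf.prob p G"
proof -
  have ne: "set_pmf p \<inter> G \<noteq> {}"
    using pos measure_measure_pmf_not_zero[of p G] measure_pmf_zero_iff[of p G] by auto
  have "measure_pmf.expectation (cond_pmf p G) h = (\<Sum>\<omega>\<in>set_pmf p. pmf (cond_pmf p G) \<omega> * h \<omega>)"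
    by (subst integral_measure_pmf[of "set_pmf p"]) (use fin set_cond_pmf[OF ne] in auto)
  also have "\<dots> = (\<Sum>\<omega>\<in>set_pmf p. pmf p \<omega> * (if \<omega> \<in> G then h \<omega> else 0)) / measure_pmf.prob p G"
    by (auto simp: pmf_cond[OF ne] sum_divide_distrib intro!: sum.cong)
  also have "(\<Sum>\<omega>\<in>set_pmf p. pmf p \<omega> * (if \<omega> \<in> G then h \<omega> else 0)) =
      measure_pmf.expectation p (\<lambda>\<omega>. if \<omega> \<in> G then h \<omega> else 0)"
    by (subst integral_measure_pmf[of "set_pmf p"]) (use fin in auto)
  finally show ?thesis .
qed

section \<open>Line searches on a schedule and their good event\<close>

definition line_search :: "real \<Rightarrow> (nat \<Rightarrow> nat) \<Rightarrow> (nat \<Rightarrow> nat) \<Rightarrow> nat \<Rightarrow> nat \<Rightarrow> (nat \<Rightarrow> real) \<Rightarrow> lsearch"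
where
  "line_search W s r k i y = tournament (r k) (steps W (s k)) 0"

text \<open>The schedules \<open>s\<close> and \<open>r\<close> and the range \<open>V\<close>
  determine the algorithm, while \<open>\<epsilon>\<close> and \<open>\<gamma>\<close> enter only
  its analysis. The grid range has to be fixed beforehand; the assumption \<open>range\<close> makes
  \<open>V\<close> a bound on the gap along every good run.\<close>

locale comparison_descent = smooth_strongly_convex +
  fixes Orc :: "(nat \<Rightarrow> real) \<Rightarrow> (nat \<Rightarrow> real) \<Rightarrow> bool pmf" and x0 :: "nat \<Rightarrow> real"
    and D V \<eta> :: real and m :: nat and s r :: "nat \<Rightarrow> nat" and \<epsilon> \<gamma> :: "nat \<Rightarrow> real"
  assumes x0: "x0 \<in> Rn n" and initial_gap: "f x0 - fmin n f \<le> D"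
    and resolution_nonneg: "\<And>k. k < m \<Longrightarrow> 0 \<le> \<epsilon> k"
    and advantage_nonneg: "\<And>k. k < m \<Longrightarrow> 0 \<le> \<gamma> k"
    and reliable: "\<And>k x y. k < m \<Longrightarrow> x \<in> Rn n \<Longrightarrow> y \<in> Rn n \<Longrightarrow> \<epsilon> k < \<bar>f y - f x\<bar> \<Longrightarrow>
          1/2 + \<gamma> k \<le> pmf (Orc x y) (f x < f y)"
    and vote_error: "\<And>k. k < m \<Longrightarrow> exp (- (real (r k) * (\<gamma> k)\<^sup>2)) \<le> \<eta>"
    and range: "D + (\<Sum>k<m. 2 * real (Suc (s k)) * \<epsilon> k) \<le> V"
begin

definition noise :: "nat \<Rightarrow> real" where
  "noise k = 2 * real (Suc (s k)) * \<epsilon> k"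

definition LS :: "nat \<Rightarrow> nat \<Rightarrow> (nat \<Rightarrow> real) \<Rightarrow> lsearch" where
  "LS = line_search (sqrt (V / L)) s r"

definition run :: "nat \<Rightarrow> ((nat \<Rightarrow> real) \<times> (nat \<times> bool list) list) pmf" where
  "run = cd_run n Orc LS x0"

definition good_step :: "nat \<Rightarrow> (nat \<Rightarrow> real) \<Rightarrow> nat \<Rightarrow> real \<Rightarrow> bool" where
  "good_step k y i t \<longleftrightarrow>
     (\<forall>u\<in>insert 0 (set (steps (sqrt (V / L)) (s k))). f (move y i t) \<le> f (move y i u) + noise k)"

definition good :: "nat \<Rightarrow> (nat \<times> bool list) list \<Rightarrow> bool" where
  "good k tr \<longleftrightarrow> (\<forall>j<k. good_step j (position LS x0 tr j) (fst (tr ! j))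
      (replay (LS j (fst (tr ! j)) (position LS x0 tr j)) (snd (tr ! j))))"

text \<open>The expectation is restricted to the good event but not divided by its probability. As
  good histories have good prefixes, it obeys a one-step recursion.\<close>

definition good_gap :: "nat \<Rightarrow> real" where
  "good_gap k = measure_pmf.expectation (run k) (\<lambda>(y, tr). if good k tr then gap y else 0)"

lemma noise_nonneg: "k < m \<Longrightarrow> 0 \<le> noise k"
  using resolution_nonneg by (simp add: noise_def)

lemma finite_run: "finite (set_pmf (run k))"
  unfolding run_def using n_pos by (rule finite_set_pmf_cd_run)

lemma good_snoc:
  assumes "(y, tr) \<in> set_pmf (run k)" "(t, bs) \<in> set_pmf (ls_run Orc y i (LS k i y))"
  shows "good (Suc k) (tr @ [(i, bs)]) \<longleftrightarrow> good k tr \<and> good_step k y i t"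
proof -
  have "length tr = k" "position LS x0 tr k = y"
    using cd_run_support[OF n_pos x0] assms(1) by (auto simp: run_def)
  then show ?thesis
    using replay_ls_run[OF assms(2)]
    by (auto simp: good_def less_Suc_eq position_append nth_append all_conj_distrib)
qed

lemma good_step_failure:
  assumes "k < m" "y \<in> Rn n" "i < n"
  shows "failure Orc y i (good_step k y i) (LS k i y) \<le> 2 * real (Suc (s k)) * \<eta>"
proof -
  have "failure Orc y i (good_step k y i) (LS k i y)
      \<le> 2 * real (Suc (s k)) * exp (- (real (r k) * (\<gamma> k)\<^sup>2))"
    using failure_tournament[where \<phi> = "\<lambda>t. f (move y i t)" and x = y and i = i and Orc = Orc
        and \<gamma> = "\<gamma> k" and \<epsilon> = "\<epsilon> k" and us = "steps (sqrt (V / L)) (s k)" and c = 0 and r = "r k"]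
      advantage_nonneg resolution_nonneg reliable assms move_Rn
    by (simp add: good_step_def[abs_def] noise_def LS_def line_search_def length_steps)
  also have "\<dots> \<le> 2 * real (Suc (s k)) * \<eta>"
    using vote_error[OF assms(1)] by (intro mult_left_mono) auto
  finally show ?thesis .
qed

text \<open>Union bound over the iterations. A history that is already bad is paid for by the
  induction hypothesis, a good one only by the failure of its next line search.\<close>

lemma not_good_prob:
  "k \<le> m \<Longrightarrow> measure_pmf.expectation (run k) (\<lambda>(y, tr). of_bool (\<not> good k tr))
     \<le> (\<Sum>j<k. 2 * real (Suc (s j)) * \<eta>)"
proof (induction k)
  case 0
  then show ?case by (simp add: good_def)
next
  case (Suc k)
  let ?b = "2 * real (Suc (s k)) * \<eta>"
  have "0 \<le> \<eta>" using vote_error[of k] Suc.prems by (smt (verit) exp_ge_zero Suc_le_lessD)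
  then have b: "0 \<le> ?b" by simp
  have "measure_pmf.expectation (run (Suc k)) (\<lambda>(y, tr). of_bool (\<not> good (Suc k) tr))
      \<le> measure_pmf.expectation (run k) (\<lambda>(y, tr). of_bool (\<not> good k tr) + ?b)"
    unfolding run_def
  proof (rule expectation_cd_run_Suc_le[OF n_pos])
    fix y tr assume run: "(y, tr) \<in> set_pmf (cd_run n Orc LS x0 k)"
    then have y: "y \<in> Rn n" using cd_run_support[OF n_pos x0] by blast
    have "measure_pmf.expectation (ls_run Orc y i (LS k i y))
         (\<lambda>(t, bs). case (move y i t, tr @ [(i, bs)]) of (y, tr) \<Rightarrow> of_bool (\<not> good (Suc k) tr))
         \<le> of_bool (\<not> good k tr) + ?b" (is "?E \<le> _") if "i < n" for i
    proof (cases "good k tr")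
      case True
      have "?E = failure Orc y i (good_step k y i) (LS k i y)"
        unfolding failure_def using run good_snoc True
        by (intro integral_cong_AE) (auto simp: AE_measure_pmf_iff run_def)
      then show ?thesis using good_step_failure[OF _ y that, of k] Suc.prems True by simp
    next
      case False
      have "?E \<le> measure_pmf.expectation (ls_run Orc y i (LS k i y)) (\<lambda>_. 1)"
        by (intro integral_mono integrable_measure_pmf_finite finite_set_pmf_ls_run) auto
      then show ?thesis using False b by simp
    qed
    then have "(\<Sum>i<n. measure_pmf.expectation (ls_run Orc y i (LS k i y))
         (\<lambda>(t, bs). case (move y i t, tr @ [(i, bs)]) of (y, tr) \<Rightarrow> of_bool (\<not> good (Suc k) tr)))
         \<le> (\<Sum>i<n. of_bool (\<not> good k tr) + ?b)"
      by (intro sum_mono) auto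
    then show "(\<Sum>i<n. measure_pmf.expectation (ls_run Orc y i (LS k i y))
         (\<lambda>(t, bs). case (move y i t, tr @ [(i, bs)]) of (y, tr) \<Rightarrow> of_bool (\<not> good (Suc k) tr)))
         \<le> real n * (case (y, tr) of (y, tr) \<Rightarrow> of_bool (\<not> good k tr) + ?b)"
      by simp
  qed
  also have "\<dots> = measure_pmf.expectation (run k) (\<lambda>(y, tr). of_bool (\<not> good k tr)) + ?b"
    unfolding case_prod_unfold
    by (subst Bochner_Integration.integral_add)
      (auto intro!: integrable_measure_pmf_finite finite_run)
  finally show ?case using Suc by simp
qed

text \<open>The displacement 0 takes part in every tournament, so a good step raises the gap by at
  most its noise. This holds on each good trace, not only in the mean.\<close>

lemma good_gap_le:
  assumes "k \<le> m" "good k tr"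
  shows "gap (position LS x0 tr k) \<le> D + (\<Sum>j<k. noise j)"
  using assms
proof (induction k)
  case 0
  then show ?case using initial_gap by (simp add: gap_def)
next
  case (Suc k)
  then have "good k tr" by (simp add: good_def)
  moreover have "gap (position LS x0 tr (Suc k)) \<le> gap (position LS x0 tr k) + noise k"
    using Suc.prems(2) by (auto simp: good_def good_step_def gap_def move_0)
  ultimately show ?case using Suc by simp
qed

lemma good_gap_le_V:
  assumes "k \<le> m" "good k tr" "(y, tr) \<in> set_pmf (run k)"
  shows "gap y \<le> V"
proof -
  have "gap y \<le> D + (\<Sum>j<k. noise j)"
    using good_gap_le[OF assms(1,2)] cd_run_support[OF n_pos x0] assms(3) by (auto simp: run_def)
  also have "\<dots> \<le> D + (\<Sum>j<m. noise j)"
    using assms(1) by (intro add_left_mono sum_mono2) (auto simp: noise_nonneg)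
  also have "\<dots> \<le> V" using range by (simp add: noise_def)
  finally show ?thesis .
qed

text \<open>The bound \<open>B\<close> is required for good steps only. Bad steps contribute 0 to
  the restricted expectation, which is why \<open>B\<close> must be nonnegative.\<close>

lemma good_gap_Suc_le:
  assumes k: "k < m"
    and step: "\<And>y i t. y \<in> Rn n \<Longrightarrow> i < n \<Longrightarrow> gap y \<le> V \<Longrightarrow> good_step k y i t \<Longrightarrow> gap (move y i t) \<le> B y i"
    and B_nonneg: "\<And>y i. y \<in> Rn n \<Longrightarrow> i < n \<Longrightarrow> 0 \<le> B y i"
    and average: "\<And>y. y \<in> Rn n \<Longrightarrow> (\<Sum>i<n. B y i) \<le> real n * (a * gap y + e)"
    and e: "0 \<le> e"
  shows "good_gap (Suc k) \<le> a * good_gap k + e"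
proof -
  have "good_gap (Suc k) \<le> measure_pmf.expectation (run k)
      (\<lambda>(y, tr). a * (if good k tr then gap y else 0) + e)"
    unfolding good_gap_def run_def
  proof (rule expectation_cd_run_Suc_le[OF n_pos])
    fix y tr assume run: "(y, tr) \<in> set_pmf (cd_run n Orc LS x0 k)"
    then have y: "y \<in> Rn n" using cd_run_support[OF n_pos x0] by blast
    let ?h = "\<lambda>i (t, bs). case (move y i t, tr @ [(i, bs)]) of
        (y, tr) \<Rightarrow> if good (Suc k) tr then gap y else 0"
    have "(\<Sum>i<n. measure_pmf.expectation (ls_run Orc y i (LS k i y)) (?h i))
        \<le> real n * (a * (if good k tr then gap y else 0) + e)"
    proof (cases "good k tr")
      case True
      then have V: "gap y \<le> V" using good_gap_le_V[of k tr y] k run by (simp add: run_def)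
      have "measure_pmf.expectation (ls_run Orc y i (LS k i y)) (?h i)
          \<le> measure_pmf.expectation (ls_run Orc y i (LS k i y)) (\<lambda>_. B y i)" if i: "i < n" for i
        by (intro integral_mono_AE integrable_measure_pmf_finite finite_set_pmf_ls_run)
          (use run good_snoc step[OF y i V] B_nonneg[OF y i] in \<open>auto simp: AE_measure_pmf_iff run_def\<close>)
      then have "(\<Sum>i<n. measure_pmf.expectation (ls_run Orc y i (LS k i y)) (?h i)) \<le> (\<Sum>i<n. B y i)"
        by (intro sum_mono) auto
      also have "\<dots> \<le> real n * (a * gap y + e)" using y by (rule average)
      finally show ?thesis using True by simp
    next
      case False
      have "measure_pmf.expectation (ls_run Orc y i (LS k i y)) (?h i) =
          measure_pmf.expectation (ls_run Orc y i (LS k i y)) (\<lambda>_. 0)" for i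
        by (intro integral_cong_AE) (use run good_snoc False in \<open>auto simp: AE_measure_pmf_iff run_def\<close>)
      then show ?thesis using False e by simp
    qed
    then show "(\<Sum>i<n. measure_pmf.expectation (ls_run Orc y i (LS k i y)) (?h i))
        \<le> real n * (case (y, tr) of (y, tr) \<Rightarrow> a * (if good k tr then gap y else 0) + e)"
      by simp
  qed
  also have "\<dots> = a * good_gap k + e"
    unfolding case_prod_unfold good_gap_def
    by (subst Bochner_Integration.integral_add)
      (auto intro!: integrable_measure_pmf_finite finite_run)
  finally show ?thesis .
qed

section \<open>Recursions for the expected gap on the good event\<close>

lemma good_gap_mono:
  assumes k: "k < m"
  shows "good_gap (Suc k) \<le> good_gap k + noise k"
proof -
  have "good_gap (Suc k) \<le> 1 * good_gap k + noise k"
    by (rule good_gap_Suc_le[OF k, where B = "\<lambda>y i. gap y + noise k"])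
      (use noise_nonneg[OF k] gap_nonneg in \<open>auto simp: good_step_def gap_def move_0\<close>)
  then show ?thesis by simp
qed

text \<open>A good step along \<open>i\<close> gains \<open>(g y i)\<^sup>2 / (8 * L)\<close> up to
  the errors. By \<open>gap_le_gradient\<close> these gains sum over the coordinates to at least
  \<open>\<tau> / (4 * L) * gap y\<close>, and averaging divides by \<open>n\<close>.\<close>

lemma good_gap_contraction:
  assumes k: "k < m"
  shows "good_gap (Suc k) \<le> (1 - \<tau> / (4 * L) / real n) * good_gap k + (V / 4 ^ s k + noise k)"
proof (rule good_gap_Suc_le[OF k, where B = "\<lambda>y i. gap y - (g y i)\<^sup>2 / (8 * L) + (V / 4 ^ s k + noise k)"])
  have "0 \<le> D" using initial_gap gap_nonneg[OF x0] by (simp add: gap_def)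
  moreover have "0 \<le> (\<Sum>k<m. 2 * real (Suc (s k)) * \<epsilon> k)"
    using resolution_nonneg by (intro sum_nonneg) auto
  ultimately have V0: "0 \<le> V" using range by linarith
  then show e: "0 \<le> V / 4 ^ s k + noise k" using noise_nonneg[OF k] by simp
  fix y :: "nat \<Rightarrow> real" assume y: "y \<in> Rn n"
  {
    fix i t assume i: "i < n" and V: "gap y \<le> V" and "good_step k y i t"
    then show "gap (move y i t) \<le> gap y - (g y i)\<^sup>2 / (8 * L) + (V / 4 ^ s k + noise k)"
      using some_step_decreases[OF y i V, of "s k"] by (force simp: good_step_def gap_def)
  }
  {
    fix i assume i: "i < n"
    have "(g y i)\<^sup>2 / (8 * L) \<le> gap y / 2"
      using gradient_component_le_gap[OF y i] L_pos by (simp add: divide_simps mult.commute)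
    then show "0 \<le> gap y - (g y i)\<^sup>2 / (8 * L) + (V / 4 ^ s k + noise k)"
      using gap_nonneg[OF y] e by simp
  }
  have "2 * \<tau> * gap y / (8 * L) \<le> (\<Sum>i<n. (g y i)\<^sup>2) / (8 * L)"
    using gap_le_gradient[OF y] L_pos by (intro divide_right_mono) auto
  moreover have "2 * \<tau> * gap y / (8 * L) = \<tau> / (4 * L) * gap y" by simp
  moreover have "real n * ((1 - \<tau> / (4 * L) / real n) * gap y + (V / 4 ^ s k + noise k))
      = real n * gap y - \<tau> / (4 * L) * gap y + real n * (V / 4 ^ s k + noise k)"
    using n_pos by (simp add: algebra_simps)
  ultimately show "(\<Sum>i<n. gap y - (g y i)\<^sup>2 / (8 * L) + (V / 4 ^ s k + noise k))
      \<le> real n * ((1 - \<tau> / (4 * L) / real n) * gap y + (V / 4 ^ s k + noise k))"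
    by (simp add: sum.distrib sum_subtractf sum_divide_distrib)
qed

lemma good_gap_nonneg: "0 \<le> good_gap k"
  unfolding good_gap_def
  by (intro integral_nonneg_AE)
    (use cd_run_support[OF n_pos x0] gap_nonneg in \<open>auto simp: AE_measure_pmf_iff run_def\<close>)

lemma expected_good_gap_le_V:
  assumes "k \<le> m"
  shows "good_gap k \<le> V"
proof -
  have V0: "0 \<le> V" using good_gap_le_V[of 0 "[]" x0] gap_nonneg[OF x0] by (simp add: good_def run_def)
  have "good_gap k \<le> measure_pmf.expectation (run k) (\<lambda>_. V)"
    unfolding good_gap_def
    by (intro integral_mono_AE integrable_measure_pmf_finite finite_run)
      (use V0 good_gap_le_V[OF assms] in \<open>auto simp: AE_measure_pmf_iff\<close>)
  then show ?thesis by simp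
qed

lemma good_gap_noiseless:
  assumes "j \<le> k" "k \<le> m" "\<And>i. j \<le> i \<Longrightarrow> i < k \<Longrightarrow> noise i = 0"
  shows "good_gap k \<le> good_gap j"
  using assms
proof (induction k rule: dec_induct)
  case (step k)
  then show ?case using good_gap_mono[of k] by simp
qed simp

lemma good_gap_phase:
  assumes "j + d \<le> m" "0 \<le> e"
    and e: "\<And>k. j \<le> k \<Longrightarrow> k < j + d \<Longrightarrow> V / 4 ^ s k + noise k \<le> e"
  shows "good_gap (j + d) \<le> exp (- (\<tau> / (4 * L) * (real d / real n))) * good_gap j + real n / (\<tau> / (4 * L)) * e"
proof -
  define c where "c = \<tau> / (4 * L)"
  have c: "0 < c" "c \<le> 1" using tau_pos tau_le_L by (auto simp: c_def)
  have cn: "c / real n \<le> 1" using c n_pos by (simp add: divide_le_eq)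
  have "good_gap (j + d) \<le> (1 - c / real n) ^ d * good_gap j + real n / c * e"
    using assms(1) e
  proof (induction d)
    case 0
    then show ?case using \<open>0 \<le> e\<close> c by simp
  next
    case (Suc d)
    have "good_gap (j + Suc d) \<le> (1 - c / real n) * good_gap (j + d) + e"
      using good_gap_contraction[of "j + d"] Suc.prems(1) Suc.prems(2)[of "j + d"] by (simp add: c_def)
    also have "\<dots> \<le> (1 - c / real n) * ((1 - c / real n) ^ d * good_gap j + real n / c * e) + e"
      using Suc cn by (intro add_right_mono mult_left_mono) auto
    also have "\<dots> = (1 - c / real n) ^ Suc d * good_gap j + real n / c * e"
      using c n_pos by (simp add: field_simps)
    finally show ?case .
  qed
  moreover have "(1 - c / real n) ^ d \<le> exp (- (c / real n)) ^ d"
    using cn exp_ge_add_one_self[of "- (c / real n)"] by (intro power_mono) auto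
  then have "(1 - c / real n) ^ d * good_gap j \<le> exp (- (c * (real d / real n))) * good_gap j"
    by (intro mult_right_mono good_gap_nonneg) (simp add: exp_of_nat_mult[symmetric] mult_ac)
  ultimately show ?thesis unfolding c_def by linarith
qed

text \<open>The good event has probability at least \<open>1 - \<delta> / 2\<close>, hence at least
  1/2, so conditioning on it at most doubles the restricted expectation.\<close>

lemma conditional_gap:
  assumes "0 < \<delta>" "\<delta> < 1" "(\<Sum>k<m. 2 * real (Suc (s k)) * \<eta>) \<le> \<delta> / 2"
  shows "\<exists>G. 1 - \<delta> \<le> measure_pmf.prob (run m) G \<and>
    measure_pmf.expectation (cond_pmf (run m) G) (\<lambda>\<omega>. f (fst \<omega>) - fmin n f) \<le> 2 * good_gap m"
proof -
  define G where "G = {\<omega> :: (nat \<Rightarrow> real) \<times> (nat \<times> bool list) list. good m (snd \<omega>)}"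
  have "measure_pmf.prob (run m) (- G) = measure_pmf.expectation (run m) (indicator (- G))"
    by simp
  also have "indicator (- G) = (\<lambda>(y, tr). of_bool (\<not> good m tr) :: real)"
    by (auto simp: G_def indicator_def)
  also have "measure_pmf.expectation (run m) \<dots> \<le> \<delta> / 2"
    using not_good_prob[of m] assms(3) by simp
  finally have G: "1 - \<delta> / 2 \<le> measure_pmf.prob (run m) G"
    using measure_pmf.prob_compl[of G "run m"] by (simp add: Compl_eq_Diff_UNIV)
  then have half: "1 / 2 \<le> measure_pmf.prob (run m) G" using assms(2) by simp
  have "measure_pmf.expectation (cond_pmf (run m) G) (\<lambda>\<omega>. f (fst \<omega>) - fmin n f) =
      good_gap m / measure_pmf.prob (run m) G"
    using half unfolding good_gap_def
    by (subst expectation_cond_pmf_finite[OF finite_run])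
      (auto simp: G_def gap_def case_prod_unfold intro!: arg_cong2[where f = "(/)"] Bochner_Integration.integral_cong)
  also have "\<dots> \<le> good_gap m / (1 / 2)"
    using half good_gap_nonneg by (intro divide_left_mono) auto
  finally show ?thesis using G assms(1) by (intro exI[of _ G]) auto
qed

end

section \<open>Budget and rates\<close>

text \<open>Each phase may spend half of the budget. The first has few votes, \<open>r1\<close> of
  order \<open>q\<close>, and \<open>K\<close> of order \<open>sqrt (T / n)\<close> up to a factor
  in \<open>q\<close>; the second has \<open>S\<close> of order \<open>q\<^sup>2\<close> and puts
  the rest into \<open>r2\<close>.\<close>

lemma schedule_exists:
  fixes n T :: nat and a q :: real
  assumes n: "1 \<le> n" and a: "0 < a" and q: "1 \<le> q" and T: "72 * (a + 1) * real n * q ^ 5 \<le> real T"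
  obtains K S r1 r2 :: nat where
    "1 \<le> r1" "r1 \<le> r2" "a * q \<le> real r1" "2 * q \<le> real K"
    "sqrt (real T / real n) \<le> 16 * (a + 1) * q * real K"
    "q\<^sup>2 \<le> real S" "real S \<le> 2 * q\<^sup>2" "real T \<le> 48 * real n * q ^ 4 * real r2"
    "n * K * (2 * Suc K * r1) + n * S * (2 * Suc S * r2) \<le> T"
proof -
  have np: "0 < real n" using n by simp
  have q2: "1 \<le> q\<^sup>2" using q by (simp add: power2_eq_square mult_ge1_I)
  have q4: "1 \<le> q ^ 4" using q by (simp add: one_le_power)
  define r1 where "r1 = nat \<lceil>a * q\<rceil>"
  have r1: "a * q \<le> real r1" "1 \<le> r1" "real r1 \<le> (a + 1) * q"
  proof -
    have "0 < a * q" using a q by simp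
    then have "0 < \<lceil>a * q\<rceil>" by simp
    then show "a * q \<le> real r1" "1 \<le> r1" unfolding r1_def by linarith+
    have "real r1 < a * q + 1" unfolding r1_def using \<open>0 < \<lceil>a * q\<rceil>\<close> by linarith
    then show "real r1 \<le> (a + 1) * q" using q by (simp add: algebra_simps)
  qed
  define S where "S = nat \<lceil>q\<^sup>2\<rceil>"
  have S: "q\<^sup>2 \<le> real S" "real S \<le> 2 * q\<^sup>2" unfolding S_def using q2 by linarith+
  have S1: "1 \<le> real S" using S q2 by linarith
  \<comment> \<open>Solves \<open>8 * n * r1 * X\<^sup>2 = T\<close>; since
    \<open>Suc K \<le> 2 * K\<close>, the first phase then costs at most
    \<open>T / 2\<close>.\<close>
  define X where "X = sqrt (real T / (8 * real n * real r1))"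
  define K where "K = nat \<lfloor>X\<rfloor>"
  \<comment> \<open>\<open>2 * q + 1 \<le> 3 * q\<close> and \<open>8 * 3\<^sup>2 = 72\<close>
    explain the constant of the threshold; the spare 1 pays for rounding \<open>X\<close>
    down.\<close>
  have "(2 * q + 1)\<^sup>2 * (8 * real n * real r1) \<le> (3 * q)\<^sup>2 * (8 * real n * ((a + 1) * q))"
    using q r1 np a by (intro mult_mono power_mono) auto
  also have "\<dots> = 72 * (a + 1) * real n * q ^ 3" by (simp add: power2_eq_square power3_eq_cube)
  also have "\<dots> \<le> 72 * (a + 1) * real n * q ^ 5"
    using q a np by (intro mult_left_mono power_increasing) auto
  finally have "(2 * q + 1)\<^sup>2 * (8 * real n * real r1) \<le> real T" using T by linarith
  then have "(2 * q + 1)\<^sup>2 \<le> real T / (8 * real n * real r1)"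
    using np r1(2) by (simp add: pos_le_divide_eq)
  then have X: "2 * q + 1 \<le> X" unfolding X_def by (rule real_le_rsqrt)
  then have K: "2 * q \<le> real K" "real K \<le> X" "X / 2 \<le> real K" unfolding K_def using q by linarith+
  have K1: "1 \<le> real K" using K(1) q by linarith
  have "sqrt (real T / real n) = sqrt (8 * real r1) * X"
    unfolding X_def real_sqrt_mult[symmetric] using r1(2) np by (simp add: field_simps)
  also have "\<dots> \<le> (8 * ((a + 1) * q)) * (2 * real K)"
  proof (intro mult_mono)
    have "sqrt (8 * real r1) \<le> sqrt ((8 * real r1)\<^sup>2)"
      using r1(2) by (intro real_sqrt_le_mono) (simp add: power2_eq_square)
    also have "\<dots> = 8 * real r1" by (simp only: real_sqrt_abs)
    finally show "sqrt (8 * real r1) \<le> 8 * ((a + 1) * q)" using r1(3) by linarith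
  qed (use K X q a in auto)
  finally have sqrt_T: "sqrt (real T / real n) \<le> 16 * (a + 1) * q * real K" by (simp add: mult_ac)
  \<comment> \<open>Twice the cost of the second phase per vote, so \<open>T div N\<close> votes
    spend at most half of \<open>T\<close>. \<open>N\<close> takes four powers of \<open>q\<close>;
    the fifth in the threshold ensures \<open>r1 \<le> r2\<close>.\<close>
  define N where "N = 4 * n * S * Suc S"
  define r2 where "r2 = T div N"
  have "real N \<le> 4 * real n * (2 * q\<^sup>2) * (3 * q\<^sup>2)"
    unfolding N_def of_nat_mult using S q2 by (intro mult_mono) auto
  also have "\<dots> = 24 * real n * q ^ 4" by (simp add: power2_eq_square power4_eq_xxxx)
  finally have N: "real N \<le> 24 * real n * q ^ 4" .
  have T': "48 * real n * q ^ 4 * ((a + 1) * q) \<le> real T"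
  proof -
    have "48 * real n * q ^ 4 * ((a + 1) * q) \<le> 72 * (a + 1) * real n * q ^ 5"
      using a q np by (simp add: eval_nat_numeral mult_ac mult_left_mono)
    then show ?thesis using T by linarith
  qed
  have N0: "0 < N" using n S1 by (simp add: N_def)
  have aq: "1 \<le> (a + 1) * q" using a q mult_mono[of 1 "a + 1" 1 q] by simp
  have "24 * real n * q ^ 4 * 1 \<le> 48 * real n * q ^ 4 * ((a + 1) * q)"
    using aq np q4 by (intro mult_mono) auto
  then have "N \<le> T" using N T' by linarith
  then have r2_1: "1 \<le> r2" unfolding r2_def using N0 by (simp add: div_greater_zero_iff Suc_le_eq)
  have "T < N * Suc r2" unfolding r2_def using dividend_less_times_div[OF N0, of T] by simp
  also have "\<dots> \<le> N * (2 * r2)" using r2_1 by (intro mult_le_mono) auto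
  finally have "real T \<le> real (N * (2 * r2))" by (simp only: of_nat_le_iff less_imp_le)
  also have "\<dots> = real N * (2 * real r2)" by simp
  also have "\<dots> \<le> 24 * real n * q ^ 4 * (2 * real r2)" using N by (intro mult_right_mono) auto
  finally have r2: "real T \<le> 48 * real n * q ^ 4 * real r2" by simp
  have "48 * real n * q ^ 4 * ((a + 1) * q) \<le> 48 * real n * q ^ 4 * real r2" using T' r2 by linarith
  then have "(a + 1) * q \<le> real r2" by (rule mult_left_le_imp_le) (use np q in auto)
  then have r12: "r1 \<le> r2" using r1(3) by simp
  have "real (n * K * (2 * Suc K * r1)) \<le> real n * real K * (2 * (2 * real K) * real r1)"
    unfolding of_nat_mult using K1 by (intro mult_mono) auto
  also have "\<dots> = (real K)\<^sup>2 * (4 * real n * real r1)" by (simp add: power2_eq_square)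
  also have "\<dots> \<le> X\<^sup>2 * (4 * real n * real r1)"
    using K K1 by (intro mult_right_mono power_mono) auto
  also have "\<dots> = real T / 2" unfolding X_def using np r1(2) by (simp add: field_simps)
  finally have cost1: "real (n * K * (2 * Suc K * r1)) \<le> real T / 2" .
  have "2 * (n * S * (2 * Suc S * r2)) = N * r2" by (simp add: N_def algebra_simps)
  also have "\<dots> \<le> T" unfolding r2_def by simp
  finally have "2 * real (n * S * (2 * Suc S * r2)) \<le> real T"
    by (metis of_nat_le_iff of_nat_mult of_nat_numeral)
  with cost1 have "real (n * K * (2 * Suc K * r1) + n * S * (2 * Suc S * r2)) \<le> real T" by simp
  then have "n * K * (2 * Suc K * r1) + n * S * (2 * Suc S * r2) \<le> T" by (simp only: of_nat_le_iff)
  with r1 r12 K S sqrt_T r2 show ?thesis by (intro that[of r1 r2 K S]) auto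
qed

text \<open>The grid error decays like \<open>4 ^ K\<close>, fast enough to absorb
  \<open>n * T \<le> exp q\<close> and still match \<open>exp (- (c * K))\<close>. Then
  \<open>K\<close> is traded for \<open>sqrt (T / n)\<close> up to a logarithmic factor.\<close>

lemma rate_noiseless:
  fixes n T K :: nat and a c q D :: real
  assumes n: "1 \<le> n" and T: "1 \<le> T" and a: "0 < a" and c: "0 < c" "c \<le> 1/2" and q: "1 \<le> q" and D: "0 < D"
    and nT: "real n * real T \<le> exp q" and K: "2 * q \<le> real K"
    and sqrt_T: "sqrt (real T / real n) \<le> 16 * (a + 1) * q * real K"
    and C: "2 * (D + (D + 1) / c) \<le> C" "16 * (a + 1) / c \<le> C"
  shows "2 * (exp (- (c * real K)) * D + real n / c * ((D + real T) / 4 ^ K))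
           \<le> C * q powr 3 * exp (- sqrt (real T / real n) / (C * q powr 3))"
proof -
  have C0: "0 < C" using C(2) a c by (smt (verit) divide_pos_pos)
  have q3: "q powr 3 = q ^ 3" using q by (simp add: powr_numeral)
  have q31: "1 \<le> q ^ 3" "q \<le> q ^ 3" using q by (auto simp: one_le_power self_le_power)
  have "D * 1 \<le> D * real T" using D T by (intro mult_left_mono) auto
  then have "D + real T \<le> (D + 1) * real T" by (simp add: algebra_simps)
  then have "real n * (D + real T) \<le> real n * ((D + 1) * real T)" by (intro mult_left_mono) auto
  also have "\<dots> = (D + 1) * (real n * real T)" by simp
  also have "\<dots> \<le> (D + 1) * exp q" using nT D by (intro mult_left_mono) auto
  finally have nDT: "real n * (D + real T) \<le> (D + 1) * exp q" .
  have "exp (real K) = exp 1 ^ K" by (simp flip: exp_of_nat_mult)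
  also have "\<dots> \<le> 4 ^ K" using exp_le by (intro power_mono) auto
  finally have "real n * (D + real T) / 4 ^ K \<le> (D + 1) * exp q / exp (real K)"
    using nDT D by (intro frac_le) auto
  also have "\<dots> = (D + 1) * exp (q - real K)" by (simp add: exp_diff)
  \<comment> \<open>\<open>q \<le> K / 2\<close> and \<open>c \<le> 1/2\<close>.\<close>
  also have "q - real K \<le> - (c * real K)"
    using K mult_right_mono[OF c(2), of "real K"] by simp
  then have "(D + 1) * exp (q - real K) \<le> (D + 1) * exp (- (c * real K))"
    using D by (intro mult_left_mono) auto
  finally have "real n * (D + real T) / 4 ^ K / c \<le> (D + 1) * exp (- (c * real K)) / c"
    using c by (intro divide_right_mono) auto
  then have "real n / c * ((D + real T) / 4 ^ K) \<le> (D + 1) * exp (- (c * real K)) / c"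
    by (simp add: mult_ac)
  then have "2 * (exp (- (c * real K)) * D + real n / c * ((D + real T) / 4 ^ K))
      \<le> 2 * (exp (- (c * real K)) * D + (D + 1) * exp (- (c * real K)) / c)"
    by (intro mult_left_mono add_left_mono) auto
  also have "\<dots> = 2 * (D + (D + 1) / c) * exp (- (c * real K))"
    by (simp add: algebra_simps add_divide_distrib)
  also have "\<dots> \<le> (C * q ^ 3) * exp (- sqrt (real T / real n) / (C * q ^ 3))"
  proof (rule mult_mono)
    have "C * 1 \<le> C * q ^ 3" using q31 C0 by (intro mult_left_mono) auto
    then show "2 * (D + (D + 1) / c) \<le> C * q ^ 3" using C(1) by simp
    have "sqrt (real T / real n) \<le> 16 * (a + 1) * (q * real K)" using sqrt_T by (simp add: mult_ac)
    also have "\<dots> \<le> (C * c) * (q ^ 3 * real K)"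
    proof (rule mult_mono)
      show "16 * (a + 1) \<le> C * c" using C(2) c by (simp add: divide_le_eq)
      show "q * real K \<le> q ^ 3 * real K" using q31 by (intro mult_right_mono) auto
    qed (use C0 c q in auto)
    finally have "sqrt (real T / real n) \<le> (c * real K) * (C * q ^ 3)" by (simp add: mult_ac)
    moreover have "0 < C * q ^ 3" using C0 q by simp
    ultimately have "sqrt (real T / real n) / (C * q ^ 3) \<le> c * real K"
      by (simp only: pos_divide_le_eq)
    then show "exp (- (c * real K)) \<le> exp (- sqrt (real T / real n) / (C * q ^ 3))" by simp
  qed (use C0 q in auto)
  finally show ?thesis unfolding q3 .
qed

text \<open>Below the threshold the exponent is at least -1, and the prefactor is at least
  \<open>3 * D\<close>, so the starting point already meets the bound.\<close>

lemma rate_noiseless_few_queries: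
  fixes n T :: nat and H q D C :: real
  assumes H: "1 \<le> H" and q: "1 \<le> q" and D: "0 < D" and n: "1 \<le> n"
    and T: "real T \<le> H * real n * q ^ 5" and C: "3 * D \<le> C" "H \<le> C"
  shows "D \<le> C * q powr 3 * exp (- sqrt (real T / real n) / (C * q powr 3))"
proof -
  have C0: "0 < C" using C(2) H by simp
  have q3: "q powr 3 = q ^ 3" using q by (simp add: powr_numeral)
  have q31: "1 \<le> q ^ 3" using q by (auto simp: one_le_power)
  have "real T / real n \<le> H * q ^ 5" using T n by (simp add: divide_le_eq mult_ac)
  also have "\<dots> \<le> C\<^sup>2 * q ^ 6"
    using H C q mult_mono[of 1 C H C] by (intro mult_mono power_increasing) (auto simp: power2_eq_square)
  also have "\<dots> = (C * q ^ 3)\<^sup>2" by (simp add: power_mult_distrib flip: power_mult)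
  finally have "sqrt (real T / real n) \<le> C * q ^ 3"
    using C0 q by (intro real_le_lsqrt) auto
  moreover have "0 < C * q ^ 3" using C0 q by simp
  ultimately have "sqrt (real T / real n) / (C * q ^ 3) \<le> 1" by (simp only: divide_le_eq_1_pos)
  then have "exp (- 1) \<le> exp (- sqrt (real T / real n) / (C * q ^ 3))" by simp
  moreover have "(1/3 :: real) \<le> exp (- 1)" using exp_le by (simp add: exp_minus field_simps)
  ultimately have e: "1/3 \<le> exp (- sqrt (real T / real n) / (C * q ^ 3))" by linarith
  have "C * 1 \<le> C * q ^ 3" using q31 C0 by (intro mult_left_mono) auto
  then have "3 * D \<le> C * q ^ 3" using C by linarith
  from mult_mono[OF this e] have "(3 * D) * (1/3) \<le> (C * q ^ 3) * exp (- sqrt (real T / real n) / (C * q ^ 3))"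
    using C0 q by simp
  then show ?thesis unfolding q3 by simp
qed

section \<open>The polynomial rate\<close>

lemma mult_power5_powr:
  fixes x q z :: real
  assumes "0 \<le> x" "0 < q" "0 \<le> z"
  shows "(x * q ^ 5 * z) powr \<alpha> = x powr \<alpha> * q powr (5 * \<alpha>) * z powr \<alpha>"
proof -
  have "q ^ 5 = q powr 5" using assms by simp
  then have "(q ^ 5) powr \<alpha> = q powr (5 * \<alpha>)" by (simp only: powr_powr)
  then show ?thesis using assms by (simp add: powr_mult)
qed

text \<open>Below the threshold \<open>(n / T) powr \<alpha>\<close> is bounded below by a constant
  over \<open>q powr (5 * \<alpha>)\<close>, which the prefactor makes up for.\<close>

lemma rate_noisy_few_queries:
  fixes n T :: nat and H q D C \<alpha> :: real
  assumes H: "1 \<le> H" and q: "1 \<le> q" and D: "0 < D" and n: "1 \<le> n" and T1: "1 \<le> T" and \<alpha>: "0 < \<alpha>"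
    and T: "real T \<le> H * real n * q ^ 5" and C: "D * H powr \<alpha> \<le> C"
  shows "D \<le> C * q powr (5 * \<alpha> + 2) * real n * (real n / real T) powr \<alpha>"
proof -
  have C0: "0 < C" using C H D by (smt (verit) mult_pos_pos powr_gt_zero)
  have "real T / real n \<le> H * q ^ 5" using T n by (simp add: divide_le_eq mult_ac)
  then have "(real T / real n) powr \<alpha> \<le> (H * q ^ 5) powr \<alpha>" using \<alpha> by (intro powr_mono2) auto
  also have "\<dots> = H powr \<alpha> * q powr (5 * \<alpha>)"
    using mult_power5_powr[of H q 1 \<alpha>] q H by simp
  finally have "(real T / real n) powr \<alpha> * (real n / real T) powr \<alpha>
      \<le> H powr \<alpha> * q powr (5 * \<alpha>) * (real n / real T) powr \<alpha>" by (intro mult_right_mono) auto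
  moreover have "(real T / real n) powr \<alpha> * (real n / real T) powr \<alpha> = 1"
    using n T1 by (simp flip: powr_mult)
  ultimately have "D * 1 \<le> D * (H powr \<alpha> * q powr (5 * \<alpha>) * (real n / real T) powr \<alpha>)"
    using D by (intro mult_left_mono) auto
  also have "\<dots> = (D * H powr \<alpha>) * q powr (5 * \<alpha>) * 1 * (real n / real T) powr \<alpha>" by simp
  also have "\<dots> \<le> C * q powr (5 * \<alpha> + 2) * real n * (real n / real T) powr \<alpha>"
  proof (rule mult_right_mono)
    have "(D * H powr \<alpha>) * q powr (5 * \<alpha>) \<le> C * q powr (5 * \<alpha> + 2)"
      by (rule mult_mono[OF C powr_mono]) (use q C0 in auto)
    then show "D * H powr \<alpha> * q powr (5 * \<alpha>) * 1 \<le> C * q powr (5 * \<alpha> + 2) * real n"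
      by (rule mult_mono) (use n C0 in auto)
  qed simp
  finally show ?thesis by simp
qed

text \<open>The initial gap of the phase and its grid error are killed because
  \<open>S \<ge> q\<^sup>2\<close> beats any multiple of \<open>q\<close> in the exponent. In the
  noise term, \<open>r2\<close> votes give \<open>q powr (5 * \<alpha>)\<close>, the length of the
  tournaments gives \<open>q\<^sup>2\<close>, and the accumulated errors give the factor
  \<open>n\<close>.\<close>

lemma rate_noisy:
  fixes n T S r2 :: nat and c q D C \<alpha> \<mu> \<epsilon> :: real
  assumes n: "1 \<le> n" and T: "1 \<le> T" and c: "0 < c" "c \<le> 1" and q: "1 \<le> q" and D: "0 < D" and \<alpha>: "0 < \<alpha>"
    and \<mu>: "0 < \<mu>" and nT: "real n * real T \<le> exp q"
    and S: "q\<^sup>2 \<le> real S" "real S \<le> 2 * q\<^sup>2" and r2: "1 \<le> r2" "real T \<le> 48 * real n * q ^ 4 * real r2"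
    and \<epsilon>: "\<epsilon> = (q / (\<mu>\<^sup>2 * real r2)) powr \<alpha>"
    and C: "2 * (1 + 1 / c) * (D + 1) * exp ((1 + \<alpha>)\<^sup>2 / (4 * c)) + 12 / c * (48 / \<mu>\<^sup>2) powr \<alpha> \<le> C"
  shows "2 * (exp (- (c * real S)) * (D + real T) + real n / c * ((D + real T) / 4 ^ S + 2 * real (Suc S) * \<epsilon>))
           \<le> C * q powr (5 * \<alpha> + 2) * real n * (real n / real T) powr \<alpha>"
proof -
  have np: "0 < real n" and Tp: "0 < real T" using n T by auto
  have q2: "1 \<le> q\<^sup>2" using q by (simp add: one_le_power)
  define A where "A = 2 * (1 + 1 / c) * (D + 1) * exp ((1 + \<alpha>)\<^sup>2 / (4 * c))"
  define B where "B = 12 / c * (48 / \<mu>\<^sup>2) powr \<alpha>"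
  define P where "P = q powr (5 * \<alpha> + 2) * real n * (real n / real T) powr \<alpha>"
  have P0: "0 \<le> P" unfolding P_def by simp
  have "D * 1 \<le> D * real T" using D T by (intro mult_left_mono) auto
  then have "D + real T \<le> (D + 1) * real T" by (simp add: algebra_simps)
  then have "real n * (D + real T) \<le> real n * ((D + 1) * real T)" by (intro mult_left_mono) auto
  also have "\<dots> = (D + 1) * (real n * real T)" by simp
  also have "\<dots> \<le> (D + 1) * exp q" using nT D by (intro mult_left_mono) auto
  finally have nDT: "real n * (D + real T) \<le> (D + 1) * exp q" .
  have "1 * (D + real T) \<le> real n * (D + real T)" using n D by (intro mult_right_mono) auto
  then have DT: "D + real T \<le> (D + 1) * exp q" using nDT by simp
  have cS: "exp (- (c * real S)) \<le> exp (- (c * q\<^sup>2))" using S(1) c by simp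
  have "exp (c * q\<^sup>2) \<le> exp (real S)"
    using S(1) c q2 mult_mono[of c 1 "q\<^sup>2" "real S"] by simp
  also have "\<dots> = exp 1 ^ S" by (simp flip: exp_of_nat_mult)
  also have "\<dots> \<le> 4 ^ S" using exp_le by (intro power_mono) auto
  finally have "real n * (D + real T) / 4 ^ S \<le> (D + 1) * exp q / exp (c * q\<^sup>2)"
    using nDT D by (intro frac_le) auto
  then have "real n * (D + real T) / 4 ^ S \<le> (D + 1) * exp q * exp (- (c * q\<^sup>2))"
    by (simp add: exp_minus divide_inverse)
  then have "real n * (D + real T) / 4 ^ S / c \<le> (D + 1) * exp q * exp (- (c * q\<^sup>2)) / c"
    using c by (intro divide_right_mono) auto
  moreover have "exp (- (c * real S)) * (D + real T) \<le> exp (- (c * q\<^sup>2)) * ((D + 1) * exp q)"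
    using cS DT D by (intro mult_mono) auto
  ultimately have "2 * (exp (- (c * real S)) * (D + real T) + real n / c * ((D + real T) / 4 ^ S))
      \<le> 2 * (1 + 1 / c) * (D + 1) * exp (q - c * q\<^sup>2)"
    by (simp add: algebra_simps exp_diff exp_minus divide_inverse)
  also have "\<dots> \<le> 2 * (1 + 1 / c) * (D + 1) * exp ((1 + \<alpha>)\<^sup>2 / (4 * c) - \<alpha> * q)"
  proof -
    \<comment> \<open>Completing the square turns \<open>q - c * q\<^sup>2\<close> into a constant
      minus \<open>\<alpha> * q\<close>, and \<open>exp (- q) \<le> n / T\<close> then yields the
      power of \<open>n / T\<close>.\<close>
    have "0 \<le> (2 * c * q - (1 + \<alpha>))\<^sup>2 / (4 * c)" using c by simp
    also have "\<dots> = c * q\<^sup>2 - (1 + \<alpha>) * q + (1 + \<alpha>)\<^sup>2 / (4 * c)"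
      using c by (simp add: power2_eq_square field_simps)
    also have "(1 + \<alpha>) * q = q + \<alpha> * q" by (simp add: distrib_right)
    finally have "q - c * q\<^sup>2 \<le> (1 + \<alpha>)\<^sup>2 / (4 * c) - \<alpha> * q" by linarith
    then show ?thesis using c D by (intro mult_left_mono) auto
  qed
  also have "\<dots> = A * exp (- (\<alpha> * q))" unfolding A_def diff_conv_add_uminus exp_add by (simp only: mult.assoc)
  also have "\<dots> \<le> A * P"
  proof (intro mult_left_mono)
    have "real T \<le> exp q" using nT n mult_right_mono[of 1 "real n" "real T"] by simp
    then have "exp (- q) \<le> 1 / real T" using Tp by (simp add: exp_minus field_simps)
    also have "\<dots> \<le> real n / real T" using n Tp by (intro divide_right_mono) auto
    finally have "exp (- q) powr \<alpha> \<le> (real n / real T) powr \<alpha>" using \<alpha> by (intro powr_mono2) auto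
    then have "1 * 1 * exp (- (\<alpha> * q)) \<le> q powr (5 * \<alpha> + 2) * real n * (real n / real T) powr \<alpha>"
      using q \<alpha> n by (intro mult_mono) (auto simp: exp_powr_real mult.commute ge_one_powr_ge_zero)
    then show "exp (- (\<alpha> * q)) \<le> P" by (simp add: P_def)
    show "0 \<le> A" using c D by (simp add: A_def)
  qed
  finally have part1: "2 * (exp (- (c * real S)) * (D + real T) + real n / c * ((D + real T) / 4 ^ S)) \<le> A * P" .
  have "q / (\<mu>\<^sup>2 * real r2) \<le> (48 / \<mu>\<^sup>2) * q ^ 5 * (real n / real T)"
  proof -
    have "q * real T \<le> q * (48 * real n * q ^ 4 * real r2)" using r2(2) q by (intro mult_left_mono) auto
    then show ?thesis using \<mu> r2(1) Tp by (simp add: field_simps eval_nat_numeral)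
  qed
  then have "\<epsilon> \<le> ((48 / \<mu>\<^sup>2) * q ^ 5 * (real n / real T)) powr \<alpha>"
    unfolding \<epsilon> using \<alpha> q by (intro powr_mono2) auto
  also have "\<dots> = (48 / \<mu>\<^sup>2) powr \<alpha> * q powr (5 * \<alpha>) * (real n / real T) powr \<alpha>"
    by (rule mult_power5_powr) (use q in auto)
  finally have eps: "\<epsilon> \<le> (48 / \<mu>\<^sup>2) powr \<alpha> * q powr (5 * \<alpha>) * (real n / real T) powr \<alpha>" .
  have "2 * (real n / c * (2 * real (Suc S) * \<epsilon>)) = 4 * real n / c * (real (Suc S) * \<epsilon>)" by simp
  also have "\<dots> \<le> 4 * real n / c * ((3 * q\<^sup>2) * ((48 / \<mu>\<^sup>2) powr \<alpha> * q powr (5 * \<alpha>) * (real n / real T) powr \<alpha>))"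
    using S q2 eps c by (intro mult_left_mono mult_mono) (auto simp: \<epsilon>)
  also have "\<dots> = B * P"
    using q by (simp add: B_def P_def powr_add powr_numeral)
  finally have part2: "2 * (real n / c * (2 * real (Suc S) * \<epsilon>)) \<le> B * P" .
  have "2 * (exp (- (c * real S)) * (D + real T) + real n / c * ((D + real T) / 4 ^ S + 2 * real (Suc S) * \<epsilon>))
    = 2 * (exp (- (c * real S)) * (D + real T) + real n / c * ((D + real T) / 4 ^ S))
      + 2 * (real n / c * (2 * real (Suc S) * \<epsilon>))"
    by (simp only: distrib_left add.assoc)
  also have "\<dots> \<le> (A + B) * P" using part1 part2 by (simp add: algebra_simps)
  also have "\<dots> \<le> C * P" using C P0 by (intro mult_right_mono) (auto simp: A_def B_def)
  finally show ?thesis by (simp add: P_def mult_ac)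
qed

section \<open>The two-phase algorithm\<close>

lemma sum_two_phases:
  fixes u v :: real
  shows "(\<Sum>k<a + b. if k < a then u else v) = real a * u + real b * v"
  by (induction b) (auto simp: algebra_simps)

text \<open>One algorithm, two bounds: the first phase provides the noiseless one, the second the
  noisy one. \<open>V = D + T\<close> is safe because there are at most \<open>T\<close> comparisons
  and each loses at most 1.\<close>

lemma two_phase_descent:
  fixes \<tau> L D \<delta> q \<epsilon> \<epsilon>' \<gamma> \<gamma>' :: real and n T K S u v :: nat
    and f :: "(nat \<Rightarrow> real) \<Rightarrow> real" and x0 :: "nat \<Rightarrow> real"
    and Orc :: "(nat \<Rightarrow> real) \<Rightarrow> (nat \<Rightarrow> real) \<Rightarrow> bool pmf"
  defines "c \<equiv> \<tau> / (4 * L)" and "V \<equiv> D + real T"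
  defines "s \<equiv> \<lambda>k. if k < n * K then K else S" and "r \<equiv> \<lambda>k. if k < n * K then u else v"
  defines "R \<equiv> cd_run n Orc (line_search (sqrt (V / L)) s r) x0 (n * K + n * S)"
  assumes "0 < \<tau>" "\<tau> \<le> L" and n: "1 \<le> n" and T: "1 \<le> T" and \<delta>: "0 < \<delta>" "\<delta> < 1"
    and x0: "x0 \<in> Rn n" and f: "f \<in> fclass \<tau> L n" and D: "f x0 - fmin n f \<le> D"
    and eps: "0 \<le> \<epsilon>" "\<epsilon> \<le> 1" "0 \<le> \<epsilon>'" "\<epsilon>' \<le> 1" and gam: "0 \<le> \<gamma>" "0 \<le> \<gamma>'"
    and reliable1: "\<And>x y. x \<in> Rn n \<Longrightarrow> y \<in> Rn n \<Longrightarrow> \<epsilon> < \<bar>f y - f x\<bar> \<Longrightarrow>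
          1/2 + \<gamma> \<le> pmf (Orc x y) (f x < f y)"
    and reliable2: "\<And>x y. x \<in> Rn n \<Longrightarrow> y \<in> Rn n \<Longrightarrow> \<epsilon>' < \<bar>f y - f x\<bar> \<Longrightarrow>
          1/2 + \<gamma>' \<le> pmf (Orc x y) (f x < f y)"
    and votes: "q \<le> real u * \<gamma>\<^sup>2" "q \<le> real v * \<gamma>'\<^sup>2" and q: "exp (- q) \<le> \<delta> / (2 * real T)"
    and uv: "1 \<le> u" "1 \<le> v"
    and cost: "n * K * (2 * Suc K * u) + n * S * (2 * Suc S * v) \<le> T"
  shows "\<exists>G. 1 - \<delta> \<le> measure_pmf.prob R G \<and>
     (\<epsilon> = 0 \<longrightarrow> \<epsilon>' = 0 \<longrightarrow>
        measure_pmf.expectation (cond_pmf R G) (\<lambda>\<omega>. f (fst \<omega>) - fmin n f)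
          \<le> 2 * (exp (- (c * real K)) * D + real n / c * (V / 4 ^ K))) \<and>
     measure_pmf.expectation (cond_pmf R G) (\<lambda>\<omega>. f (fst \<omega>) - fmin n f)
       \<le> 2 * (exp (- (c * real S)) * V + real n / c * (V / 4 ^ S + 2 * real (Suc S) * \<epsilon>'))"
proof -
  obtain g where g: "\<And>x y. x \<in> Rn n \<Longrightarrow> y \<in> Rn n \<Longrightarrow>
        f x + inner_n n (g x) (vsub y x) + \<tau> / 2 * (norm_n n (vsub x y))\<^sup>2 \<le> f y"
      "\<And>x y. x \<in> Rn n \<Longrightarrow> y \<in> Rn n \<Longrightarrow> norm_n n (vsub (g x) (g y)) \<le> L * norm_n n (vsub x y)"
      "\<exists>x\<in>Rn n. \<forall>y\<in>Rn n. f x \<le> f y"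
    using f unfolding fclass_def by blast
  define res where "res k = (if k < n * K then \<epsilon> else \<epsilon>')" for k
  define adv where "adv k = (if k < n * K then \<gamma> else \<gamma>')" for k
  define \<eta> where "\<eta> = \<delta> / (2 * real T)"
  \<comment> \<open>Used twice: with the resolutions for the total drift, and with
    \<open>\<eta>\<close> for the total failure probability.\<close>
  have comparisons: "(\<Sum>k<n * K + n * S. 2 * real (Suc (s k)) * w k) \<le> real T * w'"
    if w: "\<And>k. w k \<le> w'" "0 \<le> w'" for w :: "nat \<Rightarrow> real" and w'
  proof -
    have "(\<Sum>k<n * K + n * S. 2 * real (Suc (s k)) * w k) \<le>
        (\<Sum>k<n * K + n * S. (if k < n * K then 2 * real (Suc K) else 2 * real (Suc S)) * w')"
      using mult_left_mono[OF w(1)] by (intro sum_mono) (auto simp: s_def)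
    also have "\<dots> = (real (n * K) * (2 * real (Suc K)) + real (n * S) * (2 * real (Suc S))) * w'"
      unfolding sum_distrib_right[symmetric] sum_two_phases ..
    also have "\<dots> \<le> real T * w'"
    \<comment> \<open>Every comparison takes at least one query, so the budget also bounds the
      number of comparisons.\<close>
    proof (rule mult_right_mono)
      have "n * K * (2 * Suc K * 1) + n * S * (2 * Suc S * 1) \<le> T"
        by (rule order.trans[OF add_mono cost]) (rule mult_le_mono2, rule mult_le_mono2, use uv in simp)+
      then have "real (n * K * (2 * Suc K * 1) + n * S * (2 * Suc S * 1)) \<le> real T"
        by (simp only: of_nat_le_iff)
      then show "real (n * K) * (2 * real (Suc K)) + real (n * S) * (2 * real (Suc S)) \<le> real T"
        by (simp add: algebra_simps)
    qed (rule w(2))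
    finally show ?thesis .
  qed
  interpret comparison_descent n f g \<tau> L Orc x0 D V \<eta> "n * K + n * S" s r res adv
  proof
    fix k
    have "exp (- (real (r k) * (adv k)\<^sup>2)) \<le> exp (- q)"
      using votes by (simp add: r_def adv_def)
    then show "exp (- (real (r k) * (adv k)\<^sup>2)) \<le> \<eta>" unfolding \<eta>_def using q by (rule order.trans)
  next
    show "D + (\<Sum>k<n * K + n * S. 2 * real (Suc (s k)) * res k) \<le> V"
      using comparisons[of res 1] eps by (auto simp: V_def res_def)
  qed (use assms g in \<open>auto simp: res_def adv_def\<close>)
  have R: "R = run (n * K + n * S)" by (simp add: R_def run_def LS_def)
  have "0 \<le> \<eta>" using \<delta> by (simp add: \<eta>_def)
  then have "(\<Sum>k<n * K + n * S. 2 * real (Suc (s k)) * \<eta>) \<le> real T * \<eta>"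
    by (intro comparisons) auto
  also have "\<dots> = \<delta> / 2" using T by (simp add: \<eta>_def)
  finally obtain G where G: "1 - \<delta> \<le> measure_pmf.prob R G"
      "measure_pmf.expectation (cond_pmf R G) (\<lambda>\<omega>. f (fst \<omega>) - fmin n f) \<le> 2 * good_gap (n * K + n * S)"
    using conditional_gap[OF \<delta>] unfolding R by blast
  have V0: "0 \<le> V" using expected_good_gap_le_V[of 0] good_gap_nonneg[of 0] by simp
  have c0: "0 < c" using \<open>0 < \<tau>\<close> \<open>\<tau> \<le> L\<close> by (simp add: c_def)
  have n0: "0 < real n" using n by simp
  have first: "good_gap (n * K + n * S) \<le> exp (- (c * real K)) * D + real n / c * (V / 4 ^ K)"
    if "\<epsilon> = 0" "\<epsilon>' = 0"
  proof -
    have noise: "noise k = 0" for k using that by (simp add: noise_def res_def)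
    have error: "V / 4 ^ s k + noise k \<le> V / 4 ^ K" if "k < 0 + n * K" for k
      unfolding noise using that by (simp add: s_def)
    have "good_gap (n * K + n * S) \<le> good_gap (n * K)" by (rule good_gap_noiseless) (auto simp: noise)
    also have "\<dots> \<le> exp (- (c * real K)) * good_gap 0 + real n / c * (V / 4 ^ K)"
      using good_gap_phase[of 0 "n * K", OF _ _ error] V0 n0 by (simp add: c_def)
    also have "\<dots> \<le> exp (- (c * real K)) * D + real n / c * (V / 4 ^ K)"
      using initial_gap by (intro add_right_mono mult_left_mono) (auto simp: good_gap_def run_def good_def gap_def)
    finally show ?thesis .
  qed
  have error: "V / 4 ^ s k + noise k \<le> V / 4 ^ S + 2 * real (Suc S) * \<epsilon>'"
    if "n * K \<le> k" "k < n * K + n * S" for k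
    unfolding noise_def using that by (simp add: res_def s_def)
  have "good_gap (n * K + n * S) \<le> exp (- (c * real S)) * good_gap (n * K)
      + real n / c * (V / 4 ^ S + 2 * real (Suc S) * \<epsilon>')"
    using good_gap_phase[of "n * K" "n * S", OF _ _ error] V0 n0 eps by (simp add: c_def)
  \<comment> \<open>After a noisy first phase only the crude bound \<open>V\<close> is at
    hand.\<close>
  also have "\<dots> \<le> exp (- (c * real S)) * V + real n / c * (V / 4 ^ S + 2 * real (Suc S) * \<epsilon>')"
    using expected_good_gap_le_V by (intro add_right_mono mult_left_mono) auto
  finally show ?thesis using G first by (intro exI[of _ G]) fastforce
qed

text \<open>The guaranteed advantage is monotone in the difference of values. The case
  \<open>\<kappa> = 1\<close> is separate because \<open>0 powr 0 = 0\<close> would make the bound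
  at \<open>\<epsilon> = 0\<close> worthless.\<close>

lemma reliable_above_resolution:
  assumes "comparison_oracle n f \<kappa> \<mu> \<delta>0 Orc" "1 \<le> \<kappa>" "0 \<le> \<mu>" "0 \<le> \<epsilon>"
    and "\<gamma> \<le> \<delta>0" "\<kappa> = 1 \<Longrightarrow> \<gamma> \<le> \<mu>" "\<kappa> \<noteq> 1 \<Longrightarrow> \<gamma> \<le> \<mu> * \<epsilon> powr (\<kappa> - 1)"
    and "x \<in> Rn n" "y \<in> Rn n" "\<epsilon> < \<bar>f y - f x\<bar>"
  shows "1/2 + \<gamma> \<le> pmf (Orc x y) (f x < f y)"
proof -
  have "\<gamma> \<le> \<mu> * \<bar>f y - f x\<bar> powr (\<kappa> - 1)"
  proof (cases "\<kappa> = 1")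
    case True
    then show ?thesis using assms by auto
  next
    case False
    have "\<mu> * \<epsilon> powr (\<kappa> - 1) \<le> \<mu> * \<bar>f y - f x\<bar> powr (\<kappa> - 1)"
      using assms by (intro mult_left_mono powr_mono2) auto
    then show ?thesis using assms(7)[OF False] by simp
  qed
  moreover have "f x \<noteq> f y" using assms by auto
  ultimately show ?thesis
    using assms(1,5,8,9) unfolding comparison_oracle_def by fastforce
qed

theorem theorem2:
  fixes \<tau> L \<mu> \<delta>0 D :: real
  assumes "0 < \<tau>" and "\<tau> \<le> L" and "0 < \<mu>" and "0 < \<delta>0" and "\<delta>0 \<le> 1/2" and "0 < D"
  shows "\<exists>(C :: real \<Rightarrow> real) (p :: real \<Rightarrow> real).
    (\<forall>\<kappa>. C \<kappa> > 0 \<and> p \<kappa> \<ge> 0) \<and>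
    (\<forall>(n::nat) (T::nat) (\<delta>::real) x0.
       1 \<le> n \<longrightarrow> 1 \<le> T \<longrightarrow> 0 < \<delta> \<longrightarrow> \<delta> < 1 \<longrightarrow> x0 \<in> Rn n \<longrightarrow>
       (\<exists>(m::nat) LS.
          (\<forall>Orc. \<forall>\<omega>\<in>set_pmf (cd_run n Orc LS x0 m). num_queries \<omega> \<le> T) \<and>
          (\<forall>\<kappa>::real. 1 \<le> \<kappa> \<longrightarrow> (\<kappa> = 1 \<longrightarrow> \<mu> \<le> \<delta>0) \<longrightarrow>
             (\<forall>f\<in>fclass \<tau> L n. f x0 - fmin n f \<le> D \<longrightarrow>
               (\<forall>Orc. comparison_oracle n f \<kappa> \<mu> \<delta>0 Orc \<longrightarrow>
                 (let R = cd_run n Orc LS x0 m;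
                      lg = ln (real n * real T / \<delta>) + 1
                  in \<exists>G. measure_pmf.prob R G \<ge> 1 - \<delta> \<and>
                     measure_pmf.expectation (cond_pmf R G) (\<lambda>\<omega>. f (fst \<omega>) - fmin n f)
                       \<le> (if \<kappa> = 1
                           then C \<kappa> * lg powr p \<kappa> *
                                exp (- sqrt (real T / real n) / (C \<kappa> * lg powr p \<kappa>))
                           else C \<kappa> * lg powr p \<kappa> * real n *
                                (real n / real T) powr (1 / (2 * (\<kappa> - 1))))))))))"
proof -
  \<comment> \<open>An advantage common to all \<open>\<kappa>\<close>: valid at every nonzero
    difference for \<open>\<kappa> = 1\<close>, and at differences above 1 for
    \<open>\<kappa> > 1\<close>. Hence the vote counts and the threshold can be fixed without
    \<open>\<kappa>\<close>.\<close>
  define \<gamma>0 where "\<gamma>0 = min \<delta>0 \<mu>"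
  define a where "a = 1 / \<gamma>0\<^sup>2"
  define H where "H = 72 * (a + 1)"
  define c where "c = \<tau> / (4 * L)"
  define \<alpha> where "\<alpha> \<kappa> = 1 / (2 * (\<kappa> - 1))" for \<kappa> :: real
  define C1 where "C1 = H / c + 2 * (D + (D + 1) / c) + 3 * D"
  define C2 where "C2 \<kappa> = 2 * (1 + 1 / c) * (D + 1) * exp ((1 + \<alpha> \<kappa>)\<^sup>2 / (4 * c))
      + 12 / c * (48 / \<mu>\<^sup>2) powr \<alpha> \<kappa> + D * H powr \<alpha> \<kappa>" for \<kappa>
  define C where "C \<kappa> = (if \<kappa> \<le> 1 then C1 else C2 \<kappa>)" for \<kappa>
  define p where "p \<kappa> = (if \<kappa> \<le> 1 then 3 else 5 * \<alpha> \<kappa> + 2)" for \<kappa>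
  have \<gamma>0: "0 < \<gamma>0" "\<gamma>0 \<le> \<delta>0" "\<gamma>0 \<le> \<mu>" "0 \<le> \<gamma>0" using assms by (auto simp: \<gamma>0_def)
  have a: "0 < a" using \<gamma>0 by (simp add: a_def)
  have H: "1 \<le> H" "16 * (a + 1) \<le> H" using a by (auto simp: H_def)
  have c: "0 < c" "c \<le> 1/2" "c \<le> 1" using assms by (auto simp: c_def)
  have Hc: "H \<le> H / c" using H c by (simp add: le_divide_eq mult_left_le)
  have Dc: "0 < (D + 1) / c" using assms c by simp
  have Ha: "16 * (a + 1) / c \<le> H / c" using H c by (intro divide_right_mono) auto
  have C1: "2 * (D + (D + 1) / c) \<le> C1" "16 * (a + 1) / c \<le> C1" "3 * D \<le> C1" "H \<le> C1"
  proof -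
    define y h z where "y = (D + 1) / c" and "h = H / c" and "z = 16 * (a + 1) / c"
    have "C1 = h + 2 * (D + y) + 3 * D" by (simp add: C1_def y_def h_def)
    moreover have "0 < y" "H \<le> h" "z \<le> h" "0 < D" "1 \<le> H"
      using Dc Hc Ha \<open>0 < D\<close> H by (auto simp: y_def h_def z_def)
    ultimately have "2 * (D + y) \<le> C1 \<and> z \<le> C1 \<and> 3 * D \<le> C1 \<and> H \<le> C1"
      by auto
    then show "2 * (D + (D + 1) / c) \<le> C1" "16 * (a + 1) / c \<le> C1" "3 * D \<le> C1" "H \<le> C1"
      by (simp_all only: y_def z_def)
  qed
  have C2_pos: "0 < 2 * (1 + 1 / c) * (D + 1) * exp ((1 + \<alpha> \<kappa>)\<^sup>2 / (4 * c))"
    and C2_nonneg: "0 \<le> 12 / c * (48 / \<mu>\<^sup>2) powr \<alpha> \<kappa>" "0 \<le> D * H powr \<alpha> \<kappa>" for \<kappa>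
    using c \<open>0 < D\<close> by (auto intro!: mult_pos_pos add_pos_pos)
  have "0 < C \<kappa> \<and> 0 \<le> p \<kappa>" for \<kappa>
    using C1(4) H C2_pos[of \<kappa>] C2_nonneg[of \<kappa>] by (auto simp: C_def p_def C2_def \<alpha>_def)
  moreover have "\<exists>(m::nat) LS.
          (\<forall>Orc. \<forall>\<omega>\<in>set_pmf (cd_run n Orc LS x0 m). num_queries \<omega> \<le> T) \<and>
          (\<forall>\<kappa>::real. 1 \<le> \<kappa> \<longrightarrow> (\<kappa> = 1 \<longrightarrow> \<mu> \<le> \<delta>0) \<longrightarrow>
             (\<forall>f\<in>fclass \<tau> L n. f x0 - fmin n f \<le> D \<longrightarrow>
               (\<forall>Orc. comparison_oracle n f \<kappa> \<mu> \<delta>0 Orc \<longrightarrow>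
                 (let R = cd_run n Orc LS x0 m;
                      lg = ln (real n * real T / \<delta>) + 1
                  in \<exists>G. measure_pmf.prob R G \<ge> 1 - \<delta> \<and>
                     measure_pmf.expectation (cond_pmf R G) (\<lambda>\<omega>. f (fst \<omega>) - fmin n f)
                       \<le> (if \<kappa> = 1
                           then C \<kappa> * lg powr p \<kappa> *
                                exp (- sqrt (real T / real n) / (C \<kappa> * lg powr p \<kappa>))
                           else C \<kappa> * lg powr p \<kappa> * real n *
                                (real n / real T) powr (1 / (2 * (\<kappa> - 1))))))))"
    if n: "1 \<le> n" and T: "1 \<le> T" and \<delta>: "0 < \<delta>" "\<delta> < 1" and x0: "x0 \<in> Rn n"
    for n T :: nat and \<delta> :: real and x0
  proof -
    define q where "q = ln (real n * real T / \<delta>) + 1"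
    define bound where "bound \<kappa> = (if \<kappa> = 1 then C \<kappa> * q powr p \<kappa> *
        exp (- sqrt (real T / real n) / (C \<kappa> * q powr p \<kappa>))
      else C \<kappa> * q powr p \<kappa> * real n * (real n / real T) powr (1 / (2 * (\<kappa> - 1))))" for \<kappa>
    have nT1: "1 \<le> real n * real T" using n T mult_mono[of 1 "real n" 1 "real T"] by simp
    then have "real n * real T \<le> real n * real T / \<delta>" using \<delta> by (simp add: le_divide_eq mult_left_le)
    then have q: "1 \<le> q" "real n * real T \<le> exp (q - 1)" using nT1 by (auto simp: q_def)
    have nT: "real n * real T \<le> exp q" using q(2) exp_le_cancel_iff[of "q - 1" q] by linarith
    \<comment> \<open>\<open>exp q\<close> is \<open>exp 1 * n * T / \<delta>\<close> and
      \<open>exp 1 \<ge> 2\<close>, so \<open>T\<close> comparisons fail with total probability at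
      most \<open>\<delta> / 2\<close>.\<close>
    have exp_q: "exp (- q) \<le> \<delta> / (2 * real T)"
    proof -
      have "2 * real T / \<delta> \<le> exp 1 * (real n * real T / \<delta>)"
      proof -
        have "2 * (1 * real T) \<le> exp 1 * (real n * real T)"
          using n exp_ge_add_one_self[of 1] by (intro mult_mono) auto
        then show ?thesis using \<delta> divide_right_mono[of _ _ \<delta>] by fastforce
      qed
      also have "\<dots> = exp q" using nT1 \<delta> by (simp add: q_def exp_add)
      finally show ?thesis using T \<delta> by (simp add: exp_minus field_simps)
    qed
    show ?thesis
      unfolding Let_def q_def[symmetric] bound_def[symmetric]
    proof (cases "72 * (a + 1) * real n * q ^ 5 \<le> real T")
      \<comment> \<open>With too few queries the algorithm returns \<open>x0\<close>. The threshold
        does not involve \<open>\<kappa>\<close>.\<close>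
      case False
      have "\<exists>G. 1 - \<delta> \<le> measure_pmf.prob (cd_run n Orc LS x0 0) G \<and>
          measure_pmf.expectation (cond_pmf (cd_run n Orc LS x0 0) G) (\<lambda>\<omega>. f (fst \<omega>) - fmin n f) \<le> bound \<kappa>"
        if \<kappa>: "1 \<le> \<kappa>" and D: "f x0 - fmin n f \<le> D" for \<kappa> f Orc LS
      proof (intro exI[of _ UNIV] conjI)
        have "D \<le> bound \<kappa>"
        proof (cases "\<kappa> = 1")
          case True
          then show ?thesis
            using rate_noiseless_few_queries[OF H(1) q(1) \<open>0 < D\<close> n _ C1(3,4), of T] False
            by (simp add: bound_def C_def p_def H_def mult_ac)
        next
          case False':  False
          have "D * H powr \<alpha> \<kappa> \<le> C2 \<kappa>"
            using C2_pos[of \<kappa>] C2_nonneg[of \<kappa>] by (simp add: C2_def)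
          from rate_noisy_few_queries[OF H(1) q(1) \<open>0 < D\<close> n T _ _ this]
          show ?thesis
            using False False' \<kappa> by (simp add: bound_def C_def p_def H_def \<alpha>_def mult_ac)
        qed
        then show "measure_pmf.expectation (cond_pmf (cd_run n Orc LS x0 0) UNIV)
            (\<lambda>\<omega>. f (fst \<omega>) - fmin n f) \<le> bound \<kappa>"
          using D by (subst expectation_cond_pmf_finite) auto
      qed (use \<delta> in simp)
      then show "\<exists>(m::nat) LS.
          (\<forall>Orc. \<forall>\<omega>\<in>set_pmf (cd_run n Orc LS x0 m). num_queries \<omega> \<le> T) \<and>
          (\<forall>\<kappa>::real. 1 \<le> \<kappa> \<longrightarrow> (\<kappa> = 1 \<longrightarrow> \<mu> \<le> \<delta>0) \<longrightarrow>
             (\<forall>f\<in>fclass \<tau> L n. f x0 - fmin n f \<le> D \<longrightarrow>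
               (\<forall>Orc. comparison_oracle n f \<kappa> \<mu> \<delta>0 Orc \<longrightarrow>
                 (\<exists>G. 1 - \<delta> \<le> measure_pmf.prob (cd_run n Orc LS x0 m) G \<and>
                     measure_pmf.expectation (cond_pmf (cd_run n Orc LS x0 m) G)
                       (\<lambda>\<omega>. f (fst \<omega>) - fmin n f) \<le> bound \<kappa>))))"
        by (intro exI[of _ 0] exI) (auto simp: num_queries_def)
    next
      case True
      then obtain K S r1 r2 :: nat where r: "1 \<le> r1" "r1 \<le> r2" "a * q \<le> real r1"
          and K: "2 * q \<le> real K" "sqrt (real T / real n) \<le> 16 * (a + 1) * q * real K"
          and S: "q\<^sup>2 \<le> real S" "real S \<le> 2 * q\<^sup>2" and r2: "real T \<le> 48 * real n * q ^ 4 * real r2"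
          and cost: "n * K * (2 * Suc K * r1) + n * S * (2 * Suc S * r2) \<le> T"
        using schedule_exists[OF n a q(1)] by metis
      define LS where "LS = line_search (sqrt ((D + real T) / L))
          (\<lambda>k. if k < n * K then K else S) (\<lambda>k. if k < n * K then r1 else r2)"
      define m where "m = n * K + n * S"
      have r2_1: "1 \<le> r2" using r by simp
      have vote1: "q \<le> real r1 * \<gamma>0\<^sup>2" using r(3) \<gamma>0 by (simp add: a_def divide_le_eq)
      moreover have "real r1 * \<gamma>0\<^sup>2 \<le> real r2 * \<gamma>0\<^sup>2" using r by (intro mult_right_mono) auto
      ultimately have vote2: "q \<le> real r2 * \<gamma>0\<^sup>2" by linarith
      have "num_queries \<omega> \<le> T" if "\<omega> \<in> set_pmf (cd_run n Orc LS x0 m)" for Orc \<omega>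
      proof -
        have "num_queries \<omega> = (\<Sum>k<m. if k < n * K then 2 * Suc K * r1 else 2 * Suc S * r2)"
          by (rule num_queries_cd_run[OF n _ that])
            (auto simp: LS_def line_search_def length_steps dest!: length_tournament)
        then have "real (num_queries \<omega>) =
            (\<Sum>k<m. if k < n * K then real (2 * Suc K * r1) else real (2 * Suc S * r2))"
          by (simp only: of_nat_sum if_distrib[of real])
        also have "\<dots> = real (n * K * (2 * Suc K * r1) + n * S * (2 * Suc S * r2))"
          unfolding m_def sum_two_phases by (simp only: of_nat_add of_nat_mult)
        finally show ?thesis using cost by (simp only: of_nat_eq_iff)
      qed
      moreover have "\<exists>G. 1 - \<delta> \<le> measure_pmf.prob (cd_run n Orc LS x0 m) G \<and>
          measure_pmf.expectation (cond_pmf (cd_run n Orc LS x0 m) G) (\<lambda>\<omega>. f (fst \<omega>) - fmin n f) \<le> bound \<kappa>"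
        if \<kappa>: "1 \<le> \<kappa>" and f: "f \<in> fclass \<tau> L n" "f x0 - fmin n f \<le> D"
          and Orc: "comparison_oracle n f \<kappa> \<mu> \<delta>0 Orc" for \<kappa> f Orc
      proof (cases "\<kappa> = 1")
        case True
        have reliable: "1/2 + \<gamma>0 \<le> pmf (Orc x y) (f x < f y)"
          if "x \<in> Rn n" "y \<in> Rn n" "0 < \<bar>f y - f x\<bar>" for x y
          by (rule reliable_above_resolution[OF Orc, of 0]) (use assms \<gamma>0 that True in auto)
        obtain G where G: "1 - \<delta> \<le> measure_pmf.prob (cd_run n Orc LS x0 m) G"
          "measure_pmf.expectation (cond_pmf (cd_run n Orc LS x0 m) G) (\<lambda>\<omega>. f (fst \<omega>) - fmin n f)
            \<le> 2 * (exp (- (c * real K)) * D + real n / c * ((D + real T) / 4 ^ K))"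
          using two_phase_descent[where \<epsilon> = 0 and \<epsilon>' = 0 and \<gamma> = \<gamma>0 and \<gamma>' = \<gamma>0,
              OF assms(1,2) n T \<delta> x0 f order_refl zero_le_one order_refl zero_le_one \<gamma>0(4,4) reliable reliable vote1 vote2 exp_q r(1) r2_1 cost,
              folded c_def LS_def m_def]
          by blast
        then show ?thesis
          using rate_noiseless[OF n T a c(1,2) q(1) \<open>0 < D\<close> nT K C1(1,2)] True
          by (intro exI[of _ G]) (auto simp: bound_def C_def p_def)
      next
        case False
        then have \<kappa>1: "1 < \<kappa>" using \<kappa> by simp
        then have \<alpha>: "0 < \<alpha> \<kappa>" by (simp add: \<alpha>_def)
        \<comment> \<open>Solves
          \<open>r2 * (\<mu> * \<epsilon> powr (\<kappa> - 1))\<^sup>2 = q\<close>, so that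
          \<open>r2\<close> votes reach error \<open>exp (- q)\<close> above this difference. It
          depends on \<open>\<kappa>\<close> but occurs only in the analysis.\<close>
        define \<epsilon> where "\<epsilon> = (q / (\<mu>\<^sup>2 * real r2)) powr \<alpha> \<kappa>"
        define \<gamma> where "\<gamma> = min \<delta>0 (\<mu> * \<epsilon> powr (\<kappa> - 1))"
        have \<gamma>0_sq: "\<gamma>0\<^sup>2 \<le> \<mu>\<^sup>2" "\<gamma>0\<^sup>2 \<le> \<delta>0\<^sup>2" using \<gamma>0 by (auto intro!: power_mono)
        have "q \<le> real r2 * \<mu>\<^sup>2" "q \<le> real r2 * \<delta>0\<^sup>2"
          using vote2 \<gamma>0_sq by (auto intro: order.trans[OF _ mult_left_mono])
        note vote2' = this
        have ratio: "0 < q / (\<mu>\<^sup>2 * real r2)" "q / (\<mu>\<^sup>2 * real r2) \<le> 1"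
          using vote2'(1) q(1) r2_1 \<open>0 < \<mu>\<close> by (auto simp: divide_le_eq mult.commute)
        \<comment> \<open>\<open>\<epsilon> \<le> 1\<close> keeps the drift of the second phase
          within the budget built into \<open>V\<close>.\<close>
        have \<epsilon>1: "0 \<le> \<epsilon>" "\<epsilon> \<le> 1"
          unfolding \<epsilon>_def using ratio \<alpha> by (auto intro!: powr_le1)
        have "\<alpha> \<kappa> * (\<kappa> - 1) = 1/2" using \<kappa>1 by (simp add: \<alpha>_def field_simps)
        then have "\<epsilon> powr (\<kappa> - 1) = (q / (\<mu>\<^sup>2 * real r2)) powr (1/2)"
          by (simp only: \<epsilon>_def powr_powr)
        then have "(\<mu> * \<epsilon> powr (\<kappa> - 1))\<^sup>2 = \<mu>\<^sup>2 * (q / (\<mu>\<^sup>2 * real r2))"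
          using ratio by (simp add: power_mult_distrib powr_half_sqrt)
        also have "\<dots> = q / real r2" using \<open>0 < \<mu>\<close> by simp
        finally have "real r2 * (\<mu> * \<epsilon> powr (\<kappa> - 1))\<^sup>2 = q" using r2_1 by simp
        then have vote\<gamma>: "q \<le> real r2 * \<gamma>\<^sup>2" using vote2'(2) by (simp add: \<gamma>_def min_def)
        have \<gamma>0': "0 \<le> \<gamma>" using assms by (simp add: \<gamma>_def)
        have reliable1: "1/2 + \<gamma>0 \<le> pmf (Orc x y) (f x < f y)"
          if "x \<in> Rn n" "y \<in> Rn n" "1 < \<bar>f y - f x\<bar>" for x y
          by (rule reliable_above_resolution[OF Orc, of 1]) (use assms \<gamma>0 that \<kappa>1 in auto)
        have reliable2: "1/2 + \<gamma> \<le> pmf (Orc x y) (f x < f y)"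
          if "x \<in> Rn n" "y \<in> Rn n" "\<epsilon> < \<bar>f y - f x\<bar>" for x y
          by (rule reliable_above_resolution[OF Orc, of \<epsilon>]) (use assms \<epsilon>1 that \<kappa>1 in \<open>auto simp: \<gamma>_def\<close>)
        obtain G where G: "1 - \<delta> \<le> measure_pmf.prob (cd_run n Orc LS x0 m) G"
          "measure_pmf.expectation (cond_pmf (cd_run n Orc LS x0 m) G) (\<lambda>\<omega>. f (fst \<omega>) - fmin n f)
            \<le> 2 * (exp (- (c * real S)) * (D + real T) + real n / c * ((D + real T) / 4 ^ S + 2 * real (Suc S) * \<epsilon>))"
          using two_phase_descent[where \<epsilon> = 1 and \<epsilon>' = \<epsilon> and \<gamma> = \<gamma>0 and \<gamma>' = \<gamma>,
              OF assms(1,2) n T \<delta> x0 f zero_le_one order_refl \<epsilon>1 \<gamma>0(4) \<gamma>0' reliable1 reliable2 vote1 vote\<gamma> exp_q r(1) r2_1 cost,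
              folded c_def LS_def m_def]
          by blast
        have "2 * (1 + 1 / c) * (D + 1) * exp ((1 + \<alpha> \<kappa>)\<^sup>2 / (4 * c)) + 12 / c * (48 / \<mu>\<^sup>2) powr \<alpha> \<kappa> \<le> C2 \<kappa>"
          using C2_nonneg(2)[of \<kappa>] by (simp add: C2_def)
        from rate_noisy[OF n T c(1,3) q(1) \<open>0 < D\<close> \<alpha> \<open>0 < \<mu>\<close> nT S r2_1 r2 \<epsilon>_def this]
        show ?thesis
          using G \<kappa>1 by (intro exI[of _ G]) (auto simp: bound_def C_def p_def \<alpha>_def)
      qed
      ultimately show "\<exists>(m::nat) LS.
          (\<forall>Orc. \<forall>\<omega>\<in>set_pmf (cd_run n Orc LS x0 m). num_queries \<omega> \<le> T) \<and>
          (\<forall>\<kappa>::real. 1 \<le> \<kappa> \<longrightarrow> (\<kappa> = 1 \<longrightarrow> \<mu> \<le> \<delta>0) \<longrightarrow>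
             (\<forall>f\<in>fclass \<tau> L n. f x0 - fmin n f \<le> D \<longrightarrow>
               (\<forall>Orc. comparison_oracle n f \<kappa> \<mu> \<delta>0 Orc \<longrightarrow>
                 (\<exists>G. 1 - \<delta> \<le> measure_pmf.prob (cd_run n Orc LS x0 m) G \<and>
                     measure_pmf.expectation (cond_pmf (cd_run n Orc LS x0 m) G)
                       (\<lambda>\<omega>. f (fst \<omega>) - fmin n f) \<le> bound \<kappa>))))"
        by blast
    qed
  qed
  ultimately show ?thesis by blast
qed

end
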